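(* Let $F:2^{[n]}\to\mathbb{R}$ be submodular with $F(\emptyset)=0$ and Lovász extension $f$, let $g:\mathbb{R}^n\to\mathbb{R}$ be $\beta$-strongly convex, let $M$ be the diameter of $B(F)$, and let $p^\star=\min_{x\in\mathbb{R}^n}g(x)+f(x)$. Then at every iteration $i$ of L-KM on $(g,F)$ the duality gap $p^{(i)}-d^{(i)}$ satisfies $$p^{(i)}-d^{(i)}\le (p^\star-d^{(i)})+\frac{M^2}{2\beta}\quad\text{if } p^\star-d^{(i)}\ge \frac{M^2}{2\beta},$$ $$p^{(i)}-d^{(i)}\le M\sqrt{2(p^\star-d^{(i)})/\beta}\quad\text{otherwise.}$$ If in addition $g$ is $\alpha$-smooth (and $B(F)$ is not a single point), then $p^\star-d^{(i)}$, and hence the duality gap, converges linearly: $p^\star-d^{(i+1)}\le(1-\rho)(p^\star-d^{(i)})$ for all $i\ge 1$ such that iterations $i$ and $i+1$ are performed, where $\rho=\frac{\beta}{4\alpha}(\delta/M)^2$ and $\delta$ is the pyramidal width of $B(F)$.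
   Context: $[n]=\{1,\dots,n\}$. $F$ is submodular if $F(A)+F(B)\ge F(A\cup B)+F(A\cap B)$ for all $A,B\subseteq[n]$. With $w(A)=\sum_{k\in A}w_k$, the base polytope is $B(F)=\{w\in\mathbb{R}^n: w(A)\le F(A)\ \forall A\subseteq[n],\ w([n])=F([n])\}$, with vertex set $\mathrm{vert}(B(F))$; the Lovász extension is $f(x)=\max_{w\in B(F)}w^\top x$. A function $g$ is $\beta$-strongly convex ($\beta>0$) if $g-\frac{\beta}{2}\|\cdot\|_2^2$ is convex, and $\alpha$-smooth ($\alpha>0$) if $g-\frac{\alpha}{2}\|\cdot\|_2^2$ is concave. Algorithm L-KM with tolerance $\epsilon\ge 0$: choose a nonempty affinely independent set $\mathcal{V}^{(0)}\subseteq\mathrm{vert}(B(F))$. For $i=1,2,\dots$: (1) let $f_{(i)}(x)=\max\{w^\top x: w\in\mathcal{V}^{(i-1)}\}$ and let $x^{(i)}$ be the (unique) minimizer of $g+f_{(i)}$ over $\mathbb{R}^n$; (2) choose a vertex $v^{(i)}\in\mathrm{vert}(B(F))$ maximizing $w^\top x^{(i)}$ over $w\in B(F)$; (3) let $p^{(i)}=g(x^{(i)})+f(x^{(i)})$, $d^{(i)}=g(x^{(i)})+f_{(i)}(x^{(i)})$; stop if $p^{(i)}-d^{(i)}\le\epsilon$; (4) otherwise let $\mathcal{A}^{(i)}=\{w\in\mathcal{V}^{(i-1)}: w^\top x^{(i)}=f_{(i)}(x^{(i)})\}$ and $\mathcal{V}^{(i)}=\mathcal{A}^{(i)}\cup\{v^{(i)}\}$.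 Diameter: $\mathrm{Diam}(\mathcal{P})=\max_{v,w\in\mathcal{P}}\|v-w\|_2$. Directional width of a set $\mathcal{P}$ in direction $x\ne0$: $\mathrm{dirW}(\mathcal{P},x)=\max_{v,w\in\mathcal{P}}(v-w)^\top x/\|x\|_2$. For a finite set $\mathcal{V}\subset\mathbb{R}^n$, a direction $x\neq 0$ and $w\in\mathrm{conv}(\mathcal{V})$, the pyramid directional width is $\mathrm{PdirW}(\mathcal{V},x,w)=\min_{A\in\mathcal{A}(w)}\mathrm{dirW}(A\cup\{v(\mathcal{V},x)\},x)$, where $\mathcal{A}(w)$ is the collection of $A\subseteq\mathcal{V}$ such that $w$ is a convex combination of the elements of $A$ with all multipliers nonzero, and $v(\mathcal{V},x)$ is an element of $\operatorname{argmax}_{v\in\mathcal{V}}v^\top x$. The pyramidal width of a polytope $\mathcal{P}$ is $$\mathrm{PWidth}(\mathcal{P})=\min_{\mathcal{K}\in\mathrm{face}(\mathcal{P})}\ \min_{w\in\mathcal{K},\ x\in\mathrm{cone}(\mathcal{K}-w)\setminus\{0\}}\mathrm{PdirW}(\mathcal{K}\cap\mathrm{vert}(\mathcal{P}),x,w),$$ where $\mathrm{face}(\mathcal{P})$ is the set of faces of $\mathcal{P}$ (including $\mathcal{P}$) and $\mathrm{cone}(\mathcal{K}-w)$ is the cone of directions pointing from $w$ into $\mathcal{K}$. *)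

theory Defs
  imports "HOL-Analysis.Analysis"
begin

section \<open>Submodular functions and base polytopes\<close>

text \<open>The ground set \<open>[n]\<close> is the index type \<open>'n\<close> of class \<open>finite\<close>, so \<open>\<real>\<^sup>n\<close> is \<open>real ^ 'n\<close>.\<close>

definition submodular :: "('n::finite set \<Rightarrow> real) \<Rightarrow> bool" where
  "submodular F \<longleftrightarrow> (\<forall>A B. F A + F B \<ge> F (A \<union> B) + F (A \<inter> B))"

definition base_polytope :: "('n::finite set \<Rightarrow> real) \<Rightarrow> (real ^ 'n) set" where
  "base_polytope F =
     {w. (\<forall>A. (\<Sum>k\<in>A. w $ k) \<le> F A) \<and> (\<Sum>k\<in>UNIV. w $ k) = F UNIV}"

definition vert :: "'a::euclidean_space set \<Rightarrow> 'a set" where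
  "vert P = {v. v extreme_point_of P}"

definition lovasz_extension :: "('n::finite set \<Rightarrow> real) \<Rightarrow> real ^ 'n \<Rightarrow> real" where
  "lovasz_extension F x = (SUP w\<in>base_polytope F. w \<bullet> x)"

section \<open>Strong convexity and smoothness\<close>

definition strongly_convex :: "real \<Rightarrow> ('a::euclidean_space \<Rightarrow> real) \<Rightarrow> bool" where
  "strongly_convex \<beta> g \<longleftrightarrow> \<beta> > 0 \<and> convex_on UNIV (\<lambda>x. g x - \<beta> / 2 * (norm x)\<^sup>2)"

definition smooth_fun :: "real \<Rightarrow> ('a::euclidean_space \<Rightarrow> real) \<Rightarrow> bool" where
  "smooth_fun \<alpha> g \<longleftrightarrow> \<alpha> > 0 \<and> concave_on UNIV (\<lambda>x. g x - \<alpha> / 2 * (norm x)\<^sup>2)"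

section \<open>Pyramidal width\<close>

definition dir_width :: "'a::euclidean_space set \<Rightarrow> 'a \<Rightarrow> real" where
  "dir_width P x = (SUP (v, w)\<in>P \<times> P. (v - w) \<bullet> x / norm x)"

definition active_sets :: "'a::euclidean_space set \<Rightarrow> 'a \<Rightarrow> 'a set set" where
  "active_sets V w =
     {A. A \<subseteq> V \<and> (\<exists>u. (\<forall>a\<in>A. u a > 0) \<and> (\<Sum>a\<in>A. u a) = 1 \<and> (\<Sum>a\<in>A. u a *\<^sub>R a) = w)}"

text \<open>Meant for finite \<open>V\<close>, \<open>w \<in> convex hull V\<close> and \<open>x \<noteq> 0\<close>.  The choice among several
  maximisers of \<open>\<lambda>v. v \<bullet> x\<close> over \<open>V\<close> does not affect the value.\<close>

definition pyr_dir_width :: "'a::euclidean_space set \<Rightarrow> 'a \<Rightarrow> 'a \<Rightarrow> real" where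
  "pyr_dir_width V x w =
     (MIN A\<in>active_sets V w. dir_width (A \<union> {arg_max_on (\<lambda>v. v \<bullet> x) V}) x)"

text \<open>The nested minima over \<open>K\<close>, \<open>w\<close> and \<open>x\<close> are taken as one infimum over all admissible
  triples.  Faces without an admissible pair \<open>(w, x)\<close>, namely \<open>{}\<close> (a face in the sense of
  \<open>face_of\<close>) and the vertices, thus contribute nothing, as under the convention that an empty
  minimum is infinite.  The conic hull of \<open>K - w\<close> is the cone of directions from \<open>w\<close> into \<open>K\<close>.\<close>

definition pyr_width :: "'a::euclidean_space set \<Rightarrow> real" where
  "pyr_width P =
     Inf {pyr_dir_width (K \<inter> vert P) x w | K w x.
            K face_of P \<and> w \<in> K \<and> x \<in> conic hull ((\<lambda>k. k - w) ` K) - {0}}"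

section \<open>Algorithm L-KM\<close>

text \<open>A run is given by sequences \<open>V\<close>, \<open>x\<close>, \<open>v\<close> with \<open>V i\<close>, \<open>x i\<close>, \<open>v i\<close> standing for
  \<open>\<V>\<close>, \<open>x\<close>, \<open>v\<close> with superscript \<open>(i)\<close>.  Iterations are numbered from 1, so only \<open>V\<close> is
  used at index 0.\<close>

definition lkm_model :: "(nat \<Rightarrow> (real ^ 'n) set) \<Rightarrow> nat \<Rightarrow> real ^ 'n \<Rightarrow> real" where
  "lkm_model V i y = (MAX w\<in>V (i - 1). w \<bullet> y)"

definition lkm_p ::
  "(real ^ 'n \<Rightarrow> real) \<Rightarrow> ('n::finite set \<Rightarrow> real) \<Rightarrow> (nat \<Rightarrow> real ^ 'n) \<Rightarrow> nat \<Rightarrow> real" where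
  "lkm_p g F x i = g (x i) + lovasz_extension F (x i)"

definition lkm_d ::
  "(real ^ 'n \<Rightarrow> real) \<Rightarrow> (nat \<Rightarrow> (real ^ 'n) set) \<Rightarrow> (nat \<Rightarrow> real ^ 'n) \<Rightarrow> nat \<Rightarrow> real" where
  "lkm_d g V x i = g (x i) + lkm_model V i (x i)"

definition lkm_active ::
  "(nat \<Rightarrow> (real ^ 'n) set) \<Rightarrow> (nat \<Rightarrow> real ^ 'n) \<Rightarrow> nat \<Rightarrow> (real ^ 'n) set" where
  "lkm_active V x i = {w \<in> V (i - 1). w \<bullet> x i = lkm_model V i (x i)}"

text \<open>Iteration \<open>i\<close> is performed if none of the iterations before it met the stopping criterion.\<close>

definition lkm_performed ::
  "(real ^ 'n \<Rightarrow> real) \<Rightarrow> ('n::finite set \<Rightarrow> real) \<Rightarrow> real \<Rightarrow>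
   (nat \<Rightarrow> (real ^ 'n) set) \<Rightarrow> (nat \<Rightarrow> real ^ 'n) \<Rightarrow> nat \<Rightarrow> bool" where
  "lkm_performed g F \<epsilon> V x i \<longleftrightarrow>
     i \<ge> 1 \<and> (\<forall>j. 1 \<le> j \<and> j < i \<longrightarrow> \<not> lkm_p g F x j - lkm_d g V x j \<le> \<epsilon>)"

text \<open>The sequences are unconstrained after the run has stopped.\<close>

definition lkm_run ::
  "(real ^ 'n \<Rightarrow> real) \<Rightarrow> ('n::finite set \<Rightarrow> real) \<Rightarrow> real \<Rightarrow>
   (nat \<Rightarrow> (real ^ 'n) set) \<Rightarrow> (nat \<Rightarrow> real ^ 'n) \<Rightarrow> (nat \<Rightarrow> real ^ 'n) \<Rightarrow> bool" where
  "lkm_run g F \<epsilon> V x v \<longleftrightarrow>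
     V 0 \<noteq> {} \<and> \<not> affine_dependent (V 0) \<and> V 0 \<subseteq> vert (base_polytope F) \<and>
     (\<forall>i. lkm_performed g F \<epsilon> V x i \<longrightarrow>
        is_arg_min (\<lambda>y. g y + lkm_model V i y) (\<lambda>y. y \<in> UNIV) (x i) \<and>
        v i \<in> vert (base_polytope F) \<and>
        is_arg_max (\<lambda>w. w \<bullet> x i) (\<lambda>w. w \<in> base_polytope F) (v i) \<and>
        (\<not> lkm_p g F x i - lkm_d g V x i \<le> \<epsilon> \<longrightarrow> V i = lkm_active V x i \<union> {v i}))"

definition opt_value :: "(real ^ 'n \<Rightarrow> real) \<Rightarrow> ('n::finite set \<Rightarrow> real) \<Rightarrow> real" where
  "opt_value g F = (INF x. g x + lovasz_extension F x)"

end

theory Submission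
  imports Defs
begin

text \<open>L-KM is dual to the fully corrective Frank-Wolfe algorithm: optimality of \<open>x\<^sup>(\<^sup>i\<^sup>)\<close> yields a
  point \<open>w\<close> in the convex hull of the current vertices with \<open>- w\<close> a subgradient of \<open>g\<close> at \<open>x\<^sup>(\<^sup>i\<^sup>)\<close> and
  \<open>w \<bullet> x\<^sup>(\<^sup>i\<^sup>) = f\<^sub>(\<^sub>i\<^sub>)(x\<^sup>(\<^sup>i\<^sup>))\<close>.  Moving from \<open>w\<close> towards \<open>v\<^sup>(\<^sup>i\<^sup>)\<close> by a step \<open>t \<in> [0, 1]\<close>, strong convexity
  of \<open>g\<close> bounds both \<open>p\<^sup>\<star>\<close> and the next dual value from below by \<open>d + t G - t\<^sup>2 M\<^sup>2 / (2 \<beta>)\<close> with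
  \<open>G = p - d\<close>; optimizing over \<open>t\<close> gives the gap bounds.  For the linear rate, cocoercivity of an
  \<open>\<alpha>\<close>-smooth function at the minimizer of \<open>g + f\<close> and the pyramidal width give
  \<open>2 \<delta>\<^sup>2 (p\<^sup>\<star> - d) \<le> \<alpha> G\<^sup>2\<close>.\<close>

section \<open>Support functions and quadratic bounds\<close>

text \<open>Attainment is part of the predicate, so that it covers both
  \<open>lovasz_extension F\<close> over the base polytope and \<open>lkm_model V i\<close> over the
  convex hull of the current vertices.\<close>

definition is_support_fun :: "'a::real_inner set \<Rightarrow> ('a \<Rightarrow> real) \<Rightarrow> bool" where
  "is_support_fun C \<sigma> \<longleftrightarrow> (\<forall>y. (\<forall>c\<in>C. c \<bullet> y \<le> \<sigma> y) \<and> (\<exists>c\<in>C. c \<bullet> y = \<sigma> y))"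

lemma is_support_fun_le: "is_support_fun C \<sigma> \<Longrightarrow> c \<in> C \<Longrightarrow> c \<bullet> y \<le> \<sigma> y"
  by (auto simp: is_support_fun_def)

lemma is_support_funE:
  assumes "is_support_fun C \<sigma>" obtains c where "c \<in> C" "c \<bullet> y = \<sigma> y"
  using assms by (auto simp: is_support_fun_def)

lemma convex_on_support_fun:
  assumes "is_support_fun C \<sigma>" shows "convex_on UNIV \<sigma>"
proof (rule convex_onI)
  fix t :: real and y z :: 'a assume t: "t > 0" "t < 1"
  obtain c where c: "c \<in> C" "c \<bullet> ((1 - t) *\<^sub>R y + t *\<^sub>R z) = \<sigma> ((1 - t) *\<^sub>R y + t *\<^sub>R z)"
    using assms by (rule is_support_funE)
  have "(1 - t) * (c \<bullet> y) + t * (c \<bullet> z) \<le> (1 - t) * \<sigma> y + t * \<sigma> z"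
    using is_support_fun_le[OF assms c(1)] t by (intro add_mono mult_left_mono) auto
  then show "\<sigma> ((1 - t) *\<^sub>R y + t *\<^sub>R z) \<le> (1 - t) * \<sigma> y + t * \<sigma> z"
    unfolding c(2)[symmetric] by (simp add: inner_add_right)
qed simp

text \<open>Separating the epigraph of \<open>g\<close> from the hypograph of \<open>- \<sigma>\<close> yields a common subgradient.\<close>

lemma support_fun_minimizer_dual:
  fixes g :: "'a::euclidean_space \<Rightarrow> real"
  assumes supp: "is_support_fun C \<sigma>" and C: "convex C" "closed C" and g: "convex_on UNIV g"
    and min: "\<And>y. g x + \<sigma> x \<le> g y + \<sigma> y"
  obtains w where "w \<in> C" "w \<bullet> x = \<sigma> x" "\<And>y. g x - w \<bullet> (y - x) \<le> g y"
proof -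
  \<comment> \<open>The vertical coordinates are shifted so that the two boundaries meet at
    \<open>(x, 0)\<close>. The strict inequality in \<open>S\<close> and the minimality of
    \<open>x\<close> make \<open>S\<close> and \<open>T\<close> disjoint.\<close>
  define S where "S = {z :: 'a \<times> real. g (fst z) - g x < snd z}"
  define T where "T = {z :: 'a \<times> real. snd z \<le> \<sigma> x - \<sigma> (fst z)}"
  have "convex S"
    unfolding convex_alt
  proof clarsimp
    fix a b :: 'a and r s u :: real
    assume *: "(a, r) \<in> S" "(b, s) \<in> S" "0 \<le> u" "u \<le> 1"
    have "(1 - u) * (g a - g x - r) + u * (g b - g x - s) < 0"
    proof (cases "u = 0")
      case False
      then have "u * (g b - g x - s) < 0"
        using * by (auto simp: S_def mult_pos_neg)
      moreover have "(1 - u) * (g a - g x - r) \<le> 0"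
        using * by (auto simp: S_def intro!: mult_nonneg_nonpos)
      ultimately show ?thesis by simp
    qed (use * in \<open>auto simp: S_def\<close>)
    then show "((1 - u) *\<^sub>R a + u *\<^sub>R b, (1 - u) * r + u * s) \<in> S"
      using convex_onD[OF g *(3,4), of a b] by (simp add: S_def algebra_simps)
  qed
  moreover have "convex T"
    unfolding convex_alt
  proof clarsimp
    fix a b :: 'a and r s u :: real
    assume *: "(a, r) \<in> T" "(b, s) \<in> T" "0 \<le> u" "u \<le> 1"
    have "(1 - u) * (r + \<sigma> a - \<sigma> x) \<le> 0" "u * (s + \<sigma> b - \<sigma> x) \<le> 0"
      using * by (auto simp: T_def intro!: mult_nonneg_nonpos)
    then show "((1 - u) *\<^sub>R a + u *\<^sub>R b, (1 - u) * r + u * s) \<in> T"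
      using convex_onD[OF convex_on_support_fun[OF supp] *(3,4), of a b]
      by (simp add: T_def algebra_simps)
  qed
  moreover have "(x, 1) \<in> S" "(x, 0) \<in> T"
    by (auto simp: S_def T_def)
  moreover have "T \<inter> S = {}"
  proof -
    have "\<not> (g (fst z) - g x < snd z \<and> snd z \<le> \<sigma> x - \<sigma> (fst z))" for z
      using min[of "fst z"] by linarith
    then show ?thesis by (auto simp: S_def T_def)
  qed
  ultimately obtain n b where n: "n \<noteq> 0" "\<forall>z\<in>T. n \<bullet> z \<le> b" "\<forall>z\<in>S. b \<le> n \<bullet> z"
    using separating_hyperplane_sets[of T S] by blast
  obtain a r where nar: "n = (a, r)" by force
  have T: "a \<bullet> y + r * s \<le> b" if "s \<le> \<sigma> x - \<sigma> y" for y s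
    using n(2) that by (auto simp: T_def nar)
  have S: "b \<le> a \<bullet> y + r * s" if "g y - g x < s" for y s
    using n(3) that by (auto simp: S_def nar)
  \<comment> \<open>A normal with \<open>r < 0\<close> is impossible because \<open>S\<close> is
    unbounded upwards over \<open>x\<close>. For \<open>r = 0\<close> both sets project onto the
    whole space, which forces \<open>a = 0\<close> and hence \<open>n = 0\<close>.\<close>
  have "r > 0"
  proof (rule ccontr)
    assume "\<not> r > 0"
    then consider "r < 0" | "r = 0" by linarith
    then show False
    proof cases
      case 1
      define s where "s = 1 + \<bar>(b - a \<bullet> x) / r\<bar>"
      have "b \<le> a \<bullet> x + r * s" by (rule S) (simp add: s_def add_pos_nonneg)
      then have "s \<le> (b - a \<bullet> x) / r"
        using 1 by (simp add: field_simps)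
      then show False unfolding s_def by linarith
    next
      case 2
      have "a \<bullet> y = b" for y
        using T[of "\<sigma> x - \<sigma> y" y] S[of y "g y - g x + 1"] 2 by simp
      from this[of a] this[of 0] show False using n(1) 2 by (simp add: nar zero_prod_def)
    qed
  qed
  \<comment> \<open>After division by \<open>r\<close>, the separator is a slope: \<open>w\<close>
    is a subgradient of \<open>\<sigma>\<close> at \<open>x\<close>, and \<open>- w\<close> is one
    of \<open>g\<close> at \<open>x\<close>.\<close>
  define w where "w = (1 / r) *\<^sub>R a"
  have aw: "a \<bullet> y = r * (w \<bullet> y)" for y
    using \<open>r > 0\<close> by (simp add: w_def)
  define b' where "b' = b / r"
  have b': "b = r * b'" using \<open>r > 0\<close> by (simp add: b'_def)
  have T': "w \<bullet> y + (\<sigma> x - \<sigma> y) \<le> b'" for y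
    using T[of "\<sigma> x - \<sigma> y" y] \<open>r > 0\<close> unfolding aw b' distrib_left[symmetric] by simp
  have S': "b' \<le> w \<bullet> y + (g y - g x)" for y
  proof (rule field_le_epsilon)
    fix e :: real assume "e > 0"
    then show "b' \<le> w \<bullet> y + (g y - g x) + e"
      using S[of y "g y - g x + e"] \<open>r > 0\<close> unfolding aw b' distrib_left[symmetric] by simp
  qed
  have b'x: "b' = w \<bullet> x" using T'[of x] S'[of x] by simp
  have sub: "\<sigma> x + w \<bullet> (y - x) \<le> \<sigma> y" for y
    using T'[of y] by (simp add: b'x inner_diff_right)
  \<comment> \<open>Positive homogeneity of \<open>\<sigma>\<close>: the subgradient inequality is
    tested at \<open>x + x\<close> and at \<open>0\<close>.\<close>
  have wx: "w \<bullet> x = \<sigma> x"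
  proof (rule antisym)
    obtain c where c: "c \<in> C" "c \<bullet> (x + x) = \<sigma> (x + x)" using supp by (rule is_support_funE)
    then show "w \<bullet> x \<le> \<sigma> x"
      using is_support_fun_le[OF supp c(1), of x] sub[of "x + x"] by (simp add: inner_add_right)
    obtain c0 where "c0 \<in> C" "c0 \<bullet> 0 = \<sigma> 0" using supp by (rule is_support_funE)
    then show "\<sigma> x \<le> w \<bullet> x" using sub[of 0] by simp
  qed
  \<comment> \<open>By \<open>wx\<close> the subgradient inequality reads
    \<open>w \<bullet> y \<le> \<sigma> y\<close>. If \<open>w\<close> lay outside \<open>C\<close>,
    the normal \<open>q\<close> of a strictly separating hyperplane would violate it at
    \<open>y = - q\<close>.\<close>
  have "w \<in> C"
  proof (rule ccontr)
    assume "w \<notin> C"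
    then obtain q m where q: "q \<bullet> w < m" "\<forall>c\<in>C. m < q \<bullet> c"
      using separating_hyperplane_closed_point[OF C] by blast
    obtain c where c: "c \<in> C" "c \<bullet> (- q) = \<sigma> (- q)" using supp by (rule is_support_funE)
    show False
      using q(1) bspec[OF q(2) c(1)] c(2) sub[of "- q"]
      by (simp add: wx inner_diff_right inner_commute)
  qed
  moreover have "g x - w \<bullet> (y - x) \<le> g y" for y
    using S'[of y] by (simp add: b'x inner_diff_right)
  ultimately show ?thesis using that wx by blast
qed

text \<open>Inequalities along a segment leave a factor \<open>1 - t\<close> on one term; it
  disappears as \<open>t\<close> tends to 0 from the right.\<close>

lemma le_of_forall_scaled_le:
  fixes a b c :: real
  assumes "\<And>t. 0 < t \<Longrightarrow> t < 1 \<Longrightarrow> a + (1 - t) * b \<le> c"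
  shows "a + b \<le> c"
proof (rule tendsto_upperbound)
  show "((\<lambda>t. a + (1 - t) * b) \<longlongrightarrow> a + b) (at_right 0)"
    by (auto intro!: tendsto_eq_intros)
  show "\<forall>\<^sub>F t in at_right 0. a + (1 - t) * b \<le> c"
    using eventually_at_right_real[OF zero_less_one] by eventually_elim (use assms in auto)
qed simp

section \<open>Quadratic bounds from strong convexity and smoothness\<close>

lemma norm_convex_combination_sq:
  fixes x y :: "'a::real_inner"
  shows "(norm ((1 - t) *\<^sub>R x + t *\<^sub>R y))\<^sup>2
           = (1 - t) * (norm x)\<^sup>2 + t * (norm y)\<^sup>2 - t * (1 - t) * (norm (y - x))\<^sup>2"
  by (simp add: power2_norm_eq_inner inner_add_left inner_add_right inner_diff_left
      inner_diff_right inner_commute algebra_simps)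

lemma strongly_convexD:
  assumes "strongly_convex \<beta> g" "0 \<le> t" "t \<le> 1"
  shows "g ((1 - t) *\<^sub>R x + t *\<^sub>R y)
           \<le> (1 - t) * g x + t * g y - \<beta> / 2 * (t * (1 - t) * (norm (y - x))\<^sup>2)"
proof -
  \<comment> \<open>The rearrangement is done over plain reals; \<open>l\<close> stands for the
    defect term in \<open>norm_convex_combination_sq\<close>.\<close>
  have *: "c \<le> (1 - t) * p + t * q - k * l"
    if "c - k * ((1 - t) * a + t * b - l) \<le> (1 - t) * (p - k * a) + t * (q - k * b)"
    for a b c k l p q :: real
    using that by (simp add: algebra_simps)
  have "convex_on UNIV (\<lambda>x. g x - \<beta> / 2 * (norm x)\<^sup>2)"
    using assms(1) by (simp add: strongly_convex_def)
  from convex_onD[OF this assms(2,3), of x y] show ?thesis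
    by (intro *[of _ "\<beta> / 2" "(norm x)\<^sup>2" "(norm y)\<^sup>2"]) (simp add: norm_convex_combination_sq)
qed

lemma smooth_funD:
  assumes "smooth_fun \<alpha> g" "0 \<le> t" "t \<le> 1"
  shows "(1 - t) * g x + t * g y - \<alpha> / 2 * (t * (1 - t) * (norm (y - x))\<^sup>2)
           \<le> g ((1 - t) *\<^sub>R x + t *\<^sub>R y)"
proof -
  have *: "(1 - t) * p + t * q - k * l \<le> c"
    if "- (c - k * ((1 - t) * a + t * b - l)) \<le> (1 - t) * - (p - k * a) + t * - (q - k * b)"
    for a b c k l p q :: real
    using that by (simp add: algebra_simps)
  have "convex_on UNIV (\<lambda>x. - (g x - \<alpha> / 2 * (norm x)\<^sup>2))"
    using assms(1) by (simp add: smooth_fun_def concave_on_def)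
  from convex_onD[OF this assms(2,3), of x y] show ?thesis
    by (intro *[of _ "\<alpha> / 2" "(norm x)\<^sup>2" "(norm y)\<^sup>2"]) (simp add: norm_convex_combination_sq)
qed

lemma strongly_convex_imp_convex_on:
  assumes "strongly_convex \<beta> g" shows "convex_on UNIV g"
proof (rule convex_onI)
  fix t :: real and x y :: 'a assume t: "0 < t" "t < 1"
  have "0 \<le> \<beta> / 2 * (t * (1 - t) * (norm (y - x))\<^sup>2)"
    using t assms by (simp add: strongly_convex_def)
  then show "g ((1 - t) *\<^sub>R x + t *\<^sub>R y) \<le> (1 - t) * g x + t * g y"
    using strongly_convexD[OF assms, of t x y] t by linarith
qed simp

text \<open>The subgradient inequality is applied a fraction \<open>t\<close> of the way from
  \<open>x\<close> to \<open>y\<close> and compared with strong convexity on the segment. Dividing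
  by \<open>t\<close> and letting \<open>t\<close> tend to 0 leaves the quadratic term.\<close>

lemma strongly_convex_subgradient_bound:
  assumes "strongly_convex \<beta> g" and sub: "\<And>y. g x + u \<bullet> (y - x) \<le> g y"
  shows "g x + u \<bullet> (y - x) + \<beta> / 2 * (norm (y - x))\<^sup>2 \<le> g y"
proof (rule le_of_forall_scaled_le)
  fix t :: real assume t: "0 < t" "t < 1"
  have "(1 - t) *\<^sub>R x + t *\<^sub>R y - x = t *\<^sub>R (y - x)" by (simp add: algebra_simps)
  then have "g x + t * (u \<bullet> (y - x)) \<le> g ((1 - t) *\<^sub>R x + t *\<^sub>R y)"
    using sub[of "(1 - t) *\<^sub>R x + t *\<^sub>R y"] by simp
  also have "\<dots> \<le> (1 - t) * g x + t * g y - \<beta> / 2 * (t * (1 - t) * (norm (y - x))\<^sup>2)"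
    using strongly_convexD[OF assms(1)] t by simp
  finally have *: "g x + t * (u \<bullet> (y - x))
      \<le> (1 - t) * g x + t * g y - \<beta> / 2 * (t * (1 - t) * (norm (y - x))\<^sup>2)" .
  have "t * (a + b + (1 - t) * (k * l)) \<le> t * c"
    if "a + t * b \<le> (1 - t) * a + t * c - k * (t * (1 - t) * l)" for a b c k l :: real
    using that by (simp add: algebra_simps)
  from this[OF *]
  have "t * (g x + u \<bullet> (y - x) + (1 - t) * (\<beta> / 2 * (norm (y - x))\<^sup>2)) \<le> t * g y" .
  then show "g x + u \<bullet> (y - x) + (1 - t) * (\<beta> / 2 * (norm (y - x))\<^sup>2) \<le> g y"
    using t by (simp only: mult_le_cancel_left_pos)
qed

text \<open>Differentiability is not required: \<open>x\<close> is a convex combination of \<open>y\<close> and a nearby point on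
  the opposite side, where the subgradient inequality bounds \<open>g\<close> from below.\<close>

lemma smooth_fun_subgradient_bound:
  assumes "smooth_fun \<alpha> g" and sub: "\<And>y. g x + u \<bullet> (y - x) \<le> g y"
  shows "g y \<le> g x + u \<bullet> (y - x) + \<alpha> / 2 * (norm (y - x))\<^sup>2"
proof -
  define z where "z = y - x"
  have "0 + (1 - s) * (g y - g x - u \<bullet> z) \<le> \<alpha> / 2 * (norm z)\<^sup>2" if s: "0 < s" "s < 1" for s :: real
  proof -
    define q where "q = x - (s / (1 - s)) *\<^sub>R z"
    have "(1 - s) *\<^sub>R q = (1 - s) *\<^sub>R x - s *\<^sub>R z"
      using s by (simp add: q_def scaleR_diff_right)
    then have x: "(1 - s) *\<^sub>R q + s *\<^sub>R y = x"
      by (simp add: z_def algebra_simps)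
    have "y - q = (1 / (1 - s)) *\<^sub>R z"
    proof -
      have "1 / (1 - s) = 1 + s / (1 - s)" using s by (simp add: field_simps)
      then show ?thesis by (simp add: q_def z_def scaleR_add_left algebra_simps)
    qed
    then have nq: "(1 - s) * (s * (1 - s) * (norm (y - q))\<^sup>2) = s * (norm z)\<^sup>2"
      using s by (simp add: power_divide power2_eq_square)
    have "g x - s / (1 - s) * (u \<bullet> z) \<le> g q"
      using sub[of q] by (simp add: q_def)
    then have "(1 - s) * (g x - s / (1 - s) * (u \<bullet> z)) \<le> (1 - s) * g q"
      using s by (intro mult_left_mono) auto
    then have "(1 - s) * g x - s * (u \<bullet> z) \<le> (1 - s) * g q"
      using s by (simp add: right_diff_distrib)
    moreover have "(1 - s) * g q + s * g y - \<alpha> / 2 * (s * (1 - s) * (norm (y - q))\<^sup>2) \<le> g x"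
      using smooth_funD[OF assms(1), of s q y] s by (simp add: x)
    ultimately have "s * (g y - g x - u \<bullet> z) \<le> \<alpha> / 2 * (s * (1 - s) * (norm (y - q))\<^sup>2)"
      by (simp add: algebra_simps)
    \<comment> \<open>As \<open>y - q\<close> is \<open>z\<close> divided by \<open>1 - s\<close>,
      multiplication by \<open>1 - s\<close> clears the denominator. The factor this leaves on the
      left disappears as \<open>s\<close> tends to 0.\<close>
    then have "(1 - s) * (s * (g y - g x - u \<bullet> z))
        \<le> (1 - s) * (\<alpha> / 2 * (s * (1 - s) * (norm (y - q))\<^sup>2))"
      using s by (intro mult_left_mono) auto
    also have "\<dots> = \<alpha> / 2 * (s * (norm z)\<^sup>2)"
      unfolding nq[symmetric] by (simp only: mult_ac)
    finally have "s * ((1 - s) * (g y - g x - u \<bullet> z)) \<le> s * (\<alpha> / 2 * (norm z)\<^sup>2)"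
      by (simp only: mult_ac)
    then have "(1 - s) * (g y - g x - u \<bullet> z) \<le> \<alpha> / 2 * (norm z)\<^sup>2"
      using s(1) by (simp only: mult_le_cancel_left_pos)
    then show ?thesis by (simp only: add_0)
  qed
  from le_of_forall_scaled_le[OF this] show ?thesis by (simp add: z_def)
qed

text \<open>At the midpoint of \<open>0\<close> and a unit vector, the same value of
  \<open>g\<close> is bounded above in terms of \<open>\<beta>\<close> and below in terms of
  \<open>\<alpha>\<close>. The inequality is what keeps the rate \<open>\<rho>\<close> at most
  \<open>1 / 4\<close>.\<close>

lemma strongly_convex_smooth_le:
  fixes g :: "'a::euclidean_space \<Rightarrow> real"
  assumes "strongly_convex \<beta> g" "smooth_fun \<alpha> g"
  shows "\<beta> \<le> \<alpha>"
proof -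
  obtain b :: 'a where "b \<in> Basis" using nonempty_Basis by blast
  then have "norm (b - 0) = 1" by simp
  then show ?thesis
    using strongly_convexD[OF assms(1), of "1/2" 0 b] smooth_funD[OF assms(2), of "1/2" 0 b]
    by simp
qed

text \<open>The value \<open>g (x + h)\<close> is bounded above by smoothness at \<open>x\<close>
  and below by the subgradient at \<open>x'\<close>. The displacement \<open>h\<close> is the one
  for which the lower bound exceeds the quadratic part of the upper bound the most.\<close>

lemma smooth_fun_cocoercive:
  assumes "smooth_fun \<alpha> g" and u: "\<And>y. g x + u \<bullet> (y - x) \<le> g y"
    and u': "\<And>y. g x' + u' \<bullet> (y - x') \<le> g y"
  shows "g x' + u' \<bullet> (x - x') + (norm (u' - u))\<^sup>2 / (2 * \<alpha>) \<le> g x"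
proof -
  have "\<alpha> > 0" using assms(1) by (simp add: smooth_fun_def)
  define h where "h = (1 / \<alpha>) *\<^sub>R (u' - u)"
  define N where "N = (norm (u' - u))\<^sup>2 / (2 * \<alpha>)"
  have "u' \<bullet> h - u \<bullet> h = 2 * N"
    by (simp add: h_def N_def power2_norm_eq_inner inner_diff_left diff_divide_distrib)
  moreover have "\<alpha> / 2 * (norm h)\<^sup>2 = N"
    using \<open>\<alpha> > 0\<close> by (simp add: h_def N_def power_mult_distrib power2_eq_square)
  then have "g (x + h) \<le> g x + u \<bullet> h + N"
    using smooth_fun_subgradient_bound[OF assms(1) u, of "x + h"] by (simp only: add_diff_cancel_left')
  moreover have "u' \<bullet> (x + h - x') = u' \<bullet> (x - x') + u' \<bullet> h"
    by (simp add: inner_add_right inner_diff_right)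
  ultimately show ?thesis
    using u'[of "x + h"] unfolding N_def[symmetric] by linarith
qed

text \<open>The infimum of the right-hand side over \<open>y\<close> is the dual objective at the
  point reached from \<open>w\<close> by a step \<open>t\<close> towards \<open>v\<close>. The
  first-order gain is \<open>t * ((v - w) \<bullet> x)\<close>, and strong convexity of
  \<open>g\<close> limits the second-order loss.\<close>

lemma strongly_convex_dual_bound:
  assumes g: "strongly_convex \<beta> g" and sub: "\<And>y. g x - w \<bullet> (y - x) \<le> g y"
    and M: "norm (v - w) \<le> M"
  shows "g x + w \<bullet> x + t * ((v - w) \<bullet> x) - t\<^sup>2 * (M\<^sup>2 / (2 * \<beta>))
           \<le> g y + ((1 - t) *\<^sub>R w + t *\<^sub>R v) \<bullet> y"
proof -
  have "\<beta> > 0" using g by (simp add: strongly_convex_def)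
  define z where "z = y - x"
  define q where "q = t *\<^sub>R (v - w)"
  \<comment> \<open>Completing the square: the quadratic term in \<open>z\<close> pays for the cross
    term \<open>q \<bullet> z\<close> at a cost quadratic in \<open>q\<close>.\<close>
  have "0 \<le> (norm (q + \<beta> *\<^sub>R z))\<^sup>2 / (2 * \<beta>)"
    using \<open>\<beta> > 0\<close> by simp
  also have "\<dots> = (norm q)\<^sup>2 / (2 * \<beta>) + q \<bullet> z + \<beta> / 2 * (norm z)\<^sup>2"
    using \<open>\<beta> > 0\<close>
    by (simp add: power2_norm_eq_inner inner_add_left inner_add_right inner_commute field_simps)
  finally have "- ((norm q)\<^sup>2 / (2 * \<beta>)) \<le> q \<bullet> z + \<beta> / 2 * (norm z)\<^sup>2" by simp
  moreover have "(norm q)\<^sup>2 / (2 * \<beta>) \<le> t\<^sup>2 * (M\<^sup>2 / (2 * \<beta>))"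
  proof -
    have "(norm q)\<^sup>2 \<le> t\<^sup>2 * M\<^sup>2"
      using M by (auto simp: q_def power_mult_distrib intro!: mult_left_mono power_mono)
    then show ?thesis using \<open>\<beta> > 0\<close> by (simp add: divide_right_mono)
  qed
  moreover have "g x - w \<bullet> z + \<beta> / 2 * (norm z)\<^sup>2 \<le> g y"
    using strongly_convex_subgradient_bound[OF g, of x "- w" y] sub by (simp add: z_def)
  moreover have "((1 - t) *\<^sub>R w + t *\<^sub>R v) \<bullet> y = w \<bullet> x + w \<bullet> z + q \<bullet> z + t * ((v - w) \<bullet> x)"
    by (simp add: q_def z_def inner_simps algebra_simps)
  ultimately show ?thesis by linarith
qed

section \<open>Pyramidal width\<close>

lemma finite_vert: "polytope P \<Longrightarrow> finite (vert P)"
  unfolding vert_def by (intro finite_polyhedron_extreme_points polytope_imp_polyhedron)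

lemma convex_hull_vert: "polytope P \<Longrightarrow> convex hull vert P = P"
  unfolding vert_def
  by (rule Krein_Milman_Minkowski[symmetric]) (auto simp: polytope_imp_compact polytope_imp_convex)

lemma vert_subset: "vert P \<subseteq> P"
  by (auto simp: vert_def extreme_point_of_def)

lemma vert_face_of: "K face_of P \<Longrightarrow> K \<inter> vert P = vert K"
  by (auto simp: vert_def extreme_point_of_face)

section \<open>Active sets and directional width\<close>

lemma active_setsD:
  assumes "A \<in> active_sets V w"
  shows "A \<subseteq> V" "finite A" "A \<noteq> {}" "w \<in> convex hull A"
proof -
  obtain u where u: "A \<subseteq> V" "\<forall>a\<in>A. u a > 0" "sum u A = 1" "(\<Sum>a\<in>A. u a *\<^sub>R a) = w"
    using assms by (auto simp: active_sets_def)
  then show "A \<subseteq> V" "A \<noteq> {}" by auto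
  \<comment> \<open>A sum over an infinite set is 0 by convention, so weights summing to 1 force
    finiteness.\<close>
  show "finite A" using u(3) by (rule contrapos_pp) simp
  then show "w \<in> convex hull A" using u less_imp_le unfolding convex_hull_finite[OF \<open>finite A\<close>] by blast
qed

lemma active_sets_mono: "A \<in> active_sets V w \<Longrightarrow> A \<subseteq> V' \<Longrightarrow> A \<in> active_sets V' w"
  by (auto simp: active_sets_def)

lemma active_sets_nonempty:
  assumes "finite V" "w \<in> convex hull V"
  obtains A where "A \<in> active_sets V w"
proof -
  obtain u where u: "\<forall>a\<in>V. 0 \<le> u a" "sum u V = 1" "(\<Sum>a\<in>V. u a *\<^sub>R a) = w"
    using assms by (auto simp: convex_hull_finite)
  define A where "A = {a \<in> V. u a > 0}"
  have "sum u A = sum u V" "(\<Sum>a\<in>A. u a *\<^sub>R a) = (\<Sum>a\<in>V. u a *\<^sub>R a)"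
    using u(1) assms(1) by (auto simp: A_def intro!: sum.mono_neutral_left)
  then have "A \<in> active_sets V w"
    using u by (auto simp: active_sets_def A_def)
  then show ?thesis by (rule that)
qed

text \<open>The slacks \<open>w \<bullet> x - a \<bullet> x\<close> are nonnegative and their
  weighted sum is 0; positive weights make each of them vanish.\<close>

lemma active_sets_maximal:
  assumes "A \<in> active_sets V w" "\<And>a. a \<in> A \<Longrightarrow> a \<bullet> x \<le> w \<bullet> x" "a \<in> A"
  shows "a \<bullet> x = w \<bullet> x"
proof -
  obtain u where u: "\<forall>a\<in>A. u a > 0" "sum u A = 1" "(\<Sum>a\<in>A. u a *\<^sub>R a) = w"
    using assms(1) by (auto simp: active_sets_def)
  have "(\<Sum>a\<in>A. u a * (w \<bullet> x - a \<bullet> x)) = sum u A * (w \<bullet> x) - (\<Sum>a\<in>A. u a *\<^sub>R a) \<bullet> x"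
    by (simp add: right_diff_distrib sum_subtractf sum_distrib_right inner_sum_left)
  then have "(\<Sum>a\<in>A. u a * (w \<bullet> x - a \<bullet> x)) = 0"
    using u by simp
  then have "\<forall>a\<in>A. u a * (w \<bullet> x - a \<bullet> x) = 0"
    using u(1) assms(2) active_setsD(2)[OF assms(1)]
    by (subst (asm) sum_nonneg_eq_0_iff) (auto intro: mult_nonneg_nonneg less_imp_le)
  then show ?thesis using u(1) assms(3) by fastforce
qed

lemma dir_width_ge:
  assumes "finite S" "v \<in> S" "w \<in> S"
  shows "(v - w) \<bullet> x / norm x \<le> dir_width S x"
  unfolding dir_width_def
  by (rule cSUP_upper2[where x = "(v, w)"]) (use assms in \<open>auto intro!: bdd_above_finite\<close>)

lemma dir_width_le:
  assumes "S \<noteq> {}" "\<And>v w. v \<in> S \<Longrightarrow> w \<in> S \<Longrightarrow> (v - w) \<bullet> x / norm x \<le> c"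
  shows "dir_width S x \<le> c"
  unfolding dir_width_def using assms by (intro cSUP_least) auto

lemma arg_max_on_finite:
  fixes f :: "'a \<Rightarrow> 'b::linorder"
  assumes "finite V" "V \<noteq> {}"
  shows "arg_max_on f V \<in> V" "\<And>v. v \<in> V \<Longrightarrow> f v \<le> f (arg_max_on f V)"
proof -
  have "Max (f ` V) \<in> f ` V" using assms by simp
  then obtain m where m: "m \<in> V" "f m = Max (f ` V)" by force
  have "arg_max f (\<lambda>x. x \<in> V) \<in> V \<and> (\<forall>v\<in>V. f v \<le> f (arg_max f (\<lambda>x. x \<in> V)))"
    by (rule arg_maxI[of "\<lambda>x. x \<in> V" m]) (use assms m in \<open>auto simp: not_less\<close>)
  then show "arg_max_on f V \<in> V" "\<And>v. v \<in> V \<Longrightarrow> f v \<le> f (arg_max_on f V)"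
    by (auto simp: arg_max_on_def)
qed

lemma finite_active_sets: "finite V \<Longrightarrow> finite (active_sets V w)"
  by (rule finite_subset[of _ "Pow V"]) (auto simp: active_sets_def)

lemma pyr_dir_width_le:
  assumes "finite V" "A \<in> active_sets V w"
  shows "pyr_dir_width V x w \<le> dir_width (A \<union> {arg_max_on (\<lambda>v. v \<bullet> x) V}) x"
  unfolding pyr_dir_width_def using assms by (intro Min_le) (auto simp: finite_active_sets)

text \<open>Membership of \<open>w\<close> in the hull guarantees an active set, so that
  \<open>Min\<close> is taken over a nonempty family.\<close>

lemma pyr_dir_width_ge:
  assumes "finite V" "w \<in> convex hull V"
    and "\<And>A. A \<in> active_sets V w \<Longrightarrow> c \<le> dir_width (A \<union> {arg_max_on (\<lambda>v. v \<bullet> x) V}) x"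
  shows "c \<le> pyr_dir_width V x w"
proof -
  obtain A where "A \<in> active_sets V w"
    using active_sets_nonempty[OF assms(1,2)] .
  then show ?thesis
    unfolding pyr_dir_width_def using assms by (subst Min_ge_iff) (auto simp: finite_active_sets)
qed

text \<open>Every nonzero \<open>x\<close> in the cone makes an acute angle with some generator, as otherwise
  \<open>x \<bullet> x \<le> 0\<close>; compactness of the unit vectors in the cone makes this uniform.  The sum of
  positive parts replaces the maximum over \<open>Q\<close> as a continuous function.\<close>

lemma finite_cone_acute:
  fixes Q :: "'a::euclidean_space set"
  assumes "finite Q"
  obtains \<delta> where "\<delta> > 0"
    "\<And>x. x \<in> conic hull (convex hull Q) \<Longrightarrow> x \<noteq> 0 \<Longrightarrow> \<exists>q\<in>Q. \<delta> * norm x \<le> q \<bullet> x"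
proof -
  define C where "C = conic hull (convex hull Q)"
  define S where "S = C \<inter> sphere 0 1"
  define \<phi> where "\<phi> x = (\<Sum>q\<in>Q. max 0 (q \<bullet> x))" for x
  have "polytope (convex hull Q)" using assms by (auto simp: polytope_def)
  then have "closed C"
    unfolding C_def by (intro polyhedron_imp_closed polyhedron_conic_hull_polytope)
  then have "compact S"
    unfolding S_def by (intro closed_Int_compact) auto
  have pos: "\<phi> x > 0" if "x \<in> S" for x
  proof -
    obtain c z where x: "x = c *\<^sub>R z" "0 \<le> c" "z \<in> convex hull Q"
      using \<open>x \<in> S\<close> by (auto simp: S_def C_def conic_hull_explicit)
    have "x \<noteq> 0" using \<open>x \<in> S\<close> by (auto simp: S_def)
    have "\<exists>q\<in>Q. q \<bullet> x > 0"
    proof (rule ccontr)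
      assume "\<not> ?thesis"
      then have "convex hull Q \<subseteq> {y. x \<bullet> y \<le> 0}"
        by (intro hull_minimal convex_halfspace_le) (auto simp: inner_commute not_less)
      then have "x \<bullet> z \<le> 0" using x(3) by blast
      then have "c * (x \<bullet> z) \<le> 0" using x(2) by (rule mult_nonneg_nonpos[rotated])
      then have "x \<bullet> x \<le> 0" using x(1) by (metis inner_scaleR_right)
      then show False using \<open>x \<noteq> 0\<close> inner_gt_zero_iff[of x] by linarith
    qed
    then obtain q where "q \<in> Q" "q \<bullet> x > 0" by blast
    then have "0 < max 0 (q \<bullet> x)" by simp
    also have "\<dots> \<le> \<phi> x"
      unfolding \<phi>_def using \<open>q \<in> Q\<close> assms by (intro member_le_sum) auto
    finally show ?thesis .
  qed
  have "continuous_on S \<phi>"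
    unfolding \<phi>_def by (intro continuous_intros)
  have "\<exists>m>0. \<forall>x\<in>S. m \<le> \<phi> x"
  proof (cases "S = {}")
    case False
    then obtain x where "x \<in> S" "\<forall>y\<in>S. \<phi> x \<le> \<phi> y"
      using continuous_attains_inf[OF \<open>compact S\<close> False \<open>continuous_on S \<phi>\<close>] by blast
    then show ?thesis using pos by blast
  qed (use zero_less_one in blast)
  then obtain m where m: "m > 0" "\<forall>x\<in>S. m \<le> \<phi> x" by blast
  \<comment> \<open>If all \<open>q \<bullet> e\<close> were at most \<open>\<delta>\<close> at a
    unit vector \<open>e\<close> of the cone, \<open>\<phi> e\<close> would be at most
    \<open>card Q * \<delta>\<close>. The added 1 makes this strictly less than \<open>m\<close> and
    keeps the denominator positive for empty \<open>Q\<close>.\<close>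
  define \<delta> where "\<delta> = m / (real (card Q) + 1)"
  have "\<delta> > 0" using m by (simp add: \<delta>_def add_nonneg_pos)
  have "\<exists>q\<in>Q. \<delta> * norm x \<le> q \<bullet> x" if "x \<in> C" "x \<noteq> 0" for x
  proof (rule ccontr)
    assume *: "\<not> ?thesis"
    define e where "e = (1 / norm x) *\<^sub>R x"
    have "conic C" unfolding C_def by (rule conic_conic_hull)
    then have "e \<in> S"
      using that by (auto simp: S_def e_def intro!: conicD)
    have "max 0 (q \<bullet> e) \<le> \<delta>" if "q \<in> Q" for q
      using * that \<open>x \<noteq> 0\<close> \<open>\<delta> > 0\<close> by (auto simp: e_def field_simps not_le less_imp_le)
    then have "\<phi> e \<le> real (card Q) * \<delta>"
      unfolding \<phi>_def by (rule sum_bounded_above)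
    also have "\<dots> < m"
      using m(1) by (simp add: \<delta>_def field_simps)
    finally show False using m(2) \<open>e \<in> S\<close> by fastforce
  qed
  then show ?thesis using that \<open>\<delta> > 0\<close> by (simp add: C_def)
qed

text \<open>Convex hulls commute with Minkowski sums and with negation.\<close>

lemma diff_in_convex_hull_differences:
  fixes A B :: "'a::euclidean_space set"
  assumes "k \<in> convex hull B" "w \<in> convex hull A"
  shows "k - w \<in> convex hull (\<Union>b\<in>B. \<Union>a\<in>A. {b - a})"
proof -
  have "- w \<in> convex hull (uminus ` A)"
    using assms(2) by (simp add: convex_hull_linear_image[OF linear_uminus, symmetric])
  with assms(1) have "k + - w \<in> convex hull (B + uminus ` A)"
    unfolding convex_hull_set_plus by (rule set_plus_intro)
  moreover have "B + uminus ` A = (\<Union>b\<in>B. \<Union>a\<in>A. {b - a})"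
    by (force simp: set_plus_def)
  ultimately show ?thesis by simp
qed

text \<open>An admissible direction lies in the cone spanned by the differences
  \<open>b - a\<close>, with \<open>b\<close> a vertex of the face and \<open>a\<close> in the
  active set. The constant from \<open>finite_cone_acute\<close> depends only on the pair of vertex
  sets, not on \<open>w\<close> or \<open>x\<close>, and there are finitely many such pairs.\<close>

lemma pyr_dir_width_uniform_lower_bound:
  fixes P :: "'a::euclidean_space set"
  assumes "polytope P"
  obtains \<delta> where "\<delta> > 0"
    "\<And>K w x. K face_of P \<Longrightarrow> w \<in> K \<Longrightarrow> x \<in> conic hull ((\<lambda>k. k - w) ` K) - {0}
       \<Longrightarrow> \<delta> \<le> pyr_dir_width (K \<inter> vert P) x w"
proof -
  define Q where "Q B A = (\<Union>b\<in>B. \<Union>a\<in>A. {b - a})" for A B :: "'a set"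
  have fin: "finite (vert P)" using assms by (rule finite_vert)
  have "\<exists>\<delta>>0. \<forall>x. x \<in> conic hull (convex hull Q B A) \<longrightarrow> x \<noteq> 0 \<longrightarrow>
      (\<exists>q\<in>Q B A. \<delta> * norm x \<le> q \<bullet> x)" if "B \<subseteq> vert P" "A \<subseteq> vert P" for A B
  proof -
    have "finite B" "finite A" using that fin finite_subset by blast+
    then have "finite (Q B A)" by (simp add: Q_def)
    then show ?thesis by (metis finite_cone_acute)
  qed
  then obtain d where d: "\<And>A B. B \<subseteq> vert P \<Longrightarrow> A \<subseteq> vert P \<Longrightarrow> d B A > 0 \<and>
      (\<forall>x. x \<in> conic hull (convex hull Q B A) \<longrightarrow> x \<noteq> 0 \<longrightarrow>
        (\<exists>q\<in>Q B A. d B A * norm x \<le> q \<bullet> x))"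
    by metis
  define \<delta> where "\<delta> = Min (\<Union>B\<in>Pow (vert P). \<Union>A\<in>Pow (vert P). {d B A})"
  have \<delta>_le: "\<delta> \<le> d B A" if "B \<subseteq> vert P" "A \<subseteq> vert P" for A B
    unfolding \<delta>_def using fin that by (intro Min_le) auto
  have "\<delta> > 0"
    unfolding \<delta>_def using fin d by (subst Min_gr_iff) auto
  moreover have "\<delta> \<le> pyr_dir_width (K \<inter> vert P) x w"
    if K: "K face_of P" and w: "w \<in> K" and x: "x \<in> conic hull ((\<lambda>k. k - w) ` K) - {0}" for K w x
  proof (rule pyr_dir_width_ge)
    define B where "B = K \<inter> vert P"
    have hull: "convex hull B = K"
      using K assms by (simp add: B_def vert_face_of convex_hull_vert face_of_polytope_polytope)
    have "finite B" using fin by (simp add: B_def)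
    then show "finite (K \<inter> vert P)" by (simp add: B_def)
    show "w \<in> convex hull (K \<inter> vert P)" using hull w by (simp add: B_def)
    fix A assume "A \<in> active_sets (K \<inter> vert P) w"
    then have A: "A \<subseteq> B" "finite A" "w \<in> convex hull A"
      unfolding B_def by (rule active_setsD)+
    have sub: "B \<subseteq> vert P" "A \<subseteq> vert P" using A by (auto simp: B_def)
    define s where "s = arg_max_on (\<lambda>v. v \<bullet> x) B"
    have "B \<noteq> {}" using hull w by auto
    note s = arg_max_on_finite[OF \<open>finite B\<close> this, where f = "\<lambda>v. v \<bullet> x", folded s_def]
    obtain c k where ck: "0 \<le> c" "k \<in> K" "x = c *\<^sub>R (k - w)" "x \<noteq> 0"
      using x by (auto simp: conic_hull_explicit)
    have "k - w \<in> convex hull Q B A"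
      unfolding Q_def using ck hull A(3) by (intro diff_in_convex_hull_differences) auto
    then have "x \<in> conic hull (convex hull Q B A)"
      using ck by (auto simp: conic_hull_explicit)
    then obtain b a where ba: "b \<in> B" "a \<in> A" "d B A * norm x \<le> (b - a) \<bullet> x"
      using d[OF sub] ck(4) by (auto simp: Q_def)
    have "\<delta> * norm x \<le> d B A * norm x"
      using \<delta>_le[OF sub] by (rule mult_right_mono) simp
    also note ba(3)
    \<comment> \<open>Replacing \<open>b\<close> by the maximizer \<open>s\<close> gives a pair
      inside \<open>A \<union> {s}\<close>, the set whose width is measured.\<close>
    also have "(b - a) \<bullet> x \<le> (s - a) \<bullet> x"
      using s(2)[OF ba(1)] by (simp add: inner_diff_left)
    finally have "\<delta> \<le> (s - a) \<bullet> x / norm x"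
      using ck(4) by (simp add: pos_le_divide_eq)
    also have "\<dots> \<le> dir_width (A \<union> {s}) x"
      using A(2) ba(2) by (intro dir_width_ge) auto
    finally show "\<delta> \<le> dir_width (A \<union> {arg_max_on (\<lambda>v. v \<bullet> x) (K \<inter> vert P)}) x"
      by (simp add: s_def B_def)
  qed
  ultimately show ?thesis by (rule that)
qed

text \<open>The uniform lower bound shows that the infimum defining \<open>pyr_width\<close> is over
  a set bounded below.\<close>

lemma pyr_width_le:
  assumes "polytope P" "K face_of P" "w \<in> K" "x \<in> conic hull ((\<lambda>k. k - w) ` K)" "x \<noteq> 0"
  shows "pyr_width P \<le> pyr_dir_width (K \<inter> vert P) x w"
proof -
  obtain \<delta> where \<delta>: "\<And>K w x. K face_of P \<Longrightarrow> w \<in> K \<Longrightarrow>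
      x \<in> conic hull ((\<lambda>k. k - w) ` K) - {0} \<Longrightarrow> \<delta> \<le> pyr_dir_width (K \<inter> vert P) x w"
    using pyr_dir_width_uniform_lower_bound[OF assms(1)] by metis
  show ?thesis
    unfolding pyr_width_def
  proof (rule cInf_lower)
    show "bdd_below {pyr_dir_width (K \<inter> vert P) x w | K w x.
            K face_of P \<and> w \<in> K \<and> x \<in> conic hull ((\<lambda>k. k - w) ` K) - {0}}"
      by (rule bdd_belowI[of _ \<delta>]) (use \<delta> in blast)
  qed (use assms in blast)
qed

lemma pyr_width_bounds:
  fixes P :: "'a::euclidean_space set"
  assumes P: "polytope P" and ab: "a \<in> P" "b \<in> P" "a \<noteq> b"
  shows "0 < pyr_width P" "pyr_width P \<le> diameter P"
proof -
  \<comment> \<open>The whole polytope with base point \<open>a\<close> and direction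
    \<open>b - a\<close> is an admissible choice. It makes the infimum range over a nonempty set and
    also supplies the upper bound.\<close>
  have adm: "P face_of P" "b - a \<in> conic hull ((\<lambda>k. k - a) ` P)" "b - a \<noteq> 0"
    using P ab by (auto simp: face_of_refl polytope_imp_convex intro!: hull_inc)
  obtain \<delta> where \<delta>: "\<delta> > 0" "\<And>K w x. K face_of P \<Longrightarrow> w \<in> K \<Longrightarrow>
      x \<in> conic hull ((\<lambda>k. k - w) ` K) - {0} \<Longrightarrow> \<delta> \<le> pyr_dir_width (K \<inter> vert P) x w"
    using pyr_dir_width_uniform_lower_bound[OF P] by metis
  have "\<delta> \<le> pyr_width P"
    unfolding pyr_width_def
  proof (rule cInf_greatest)
    show "{pyr_dir_width (K \<inter> vert P) x w | K w x.
            K face_of P \<and> w \<in> K \<and> x \<in> conic hull ((\<lambda>k. k - w) ` K) - {0}} \<noteq> {}"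
      using adm ab(1) by blast
  qed (use \<delta>(2) in blast)
  with \<open>\<delta> > 0\<close> show "0 < pyr_width P" by simp
  have PV: "P \<inter> vert P = vert P" using vert_subset by blast
  have "vert P \<noteq> {}" using convex_hull_vert[OF P] ab(1) by auto
  obtain A where A: "A \<in> active_sets (vert P) a"
    using active_sets_nonempty[OF finite_vert[OF P]] convex_hull_vert[OF P] ab(1) by blast
  define s where "s = arg_max_on (\<lambda>v. v \<bullet> (b - a)) (vert P)"
  have "s \<in> vert P"
    unfolding s_def using finite_vert[OF P] \<open>vert P \<noteq> {}\<close> by (rule arg_max_on_finite)
  then have sub: "A \<union> {s} \<subseteq> P" using active_setsD(1)[OF A] vert_subset by blast
  have "pyr_width P \<le> pyr_dir_width (vert P) (b - a) a"
    using pyr_width_le[OF P adm(1) ab(1) adm(2,3)] by (simp add: PV)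
  also have "\<dots> \<le> dir_width (A \<union> {s}) (b - a)"
    unfolding s_def using finite_vert[OF P] A by (rule pyr_dir_width_le)
  also have "\<dots> \<le> diameter P"
  proof (rule dir_width_le)
    fix v w assume "v \<in> A \<union> {s}" "w \<in> A \<union> {s}"
    then have "dist v w \<le> diameter P"
      using sub P by (intro diameter_bounded_bound polytope_imp_bounded) auto
    moreover have "(v - w) \<bullet> (b - a) \<le> norm (v - w) * norm (b - a)"
      by (rule norm_cauchy_schwarz)
    ultimately show "(v - w) \<bullet> (b - a) / norm (b - a) \<le> diameter P"
      using adm(3) by (simp add: pos_divide_le_eq dist_norm)
        (meson mult_right_mono norm_ge_zero order_trans)
  qed simp
  finally show "pyr_width P \<le> diameter P" .
qed

text \<open>Project \<open>x\<close> onto the cone of directions from \<open>w\<close> into \<open>P\<close>.  The residual \<open>n\<close> lies in the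
  polar cone, so it exposes a face of \<open>P\<close>; that face contains \<open>w\<close> with its active set, its cone
  contains the projection \<open>z\<close>, and on it \<open>x\<close> and \<open>z\<close> differ by a constant.\<close>

lemma pyr_width_gap:
  fixes P :: "'a::euclidean_space set"
  assumes P: "polytope P" and w: "w \<in> P" and w': "w' \<in> P"
    and A: "A \<in> active_sets (vert P) w" "\<And>a. a \<in> A \<Longrightarrow> a \<bullet> x = m"
    and G: "0 \<le> G" "\<And>k. k \<in> P \<Longrightarrow> k \<bullet> x \<le> m + G"
  shows "pyr_width P * ((w' - w) \<bullet> x) \<le> G * norm (w' - w)"
proof (cases "(w' - w) \<bullet> x \<le> 0")
  case True
  show ?thesis
  \<comment> \<open>The sign of the width is known from \<open>pyr_width_bounds\<close> once
    \<open>P\<close> has two distinct points; for \<open>w' = w\<close> both sides are 0.\<close>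
  proof (cases "w' = w")
    case False
    then have "0 < pyr_width P" using pyr_width_bounds(1)[OF P w w'] by simp
    then have "pyr_width P * ((w' - w) \<bullet> x) \<le> 0"
      using True by (simp add: mult_nonneg_nonpos)
    also have "0 \<le> G * norm (w' - w)" using G(1) by simp
    finally show ?thesis .
  qed simp
next
  case False
  then have "w \<noteq> w'" by auto
  define C where "C = conic hull ((\<lambda>k. k - w) ` P)"
  have "polytope ((\<lambda>k. k - w) ` P)"
    using polytope_translation_eq[of "- w" P] P by (simp add: add.commute[of "- w"] image_def)
  then have "polyhedron C" unfolding C_def by (rule polyhedron_conic_hull_polytope)
  then have C: "convex C" "closed C" by (auto intro: polyhedron_imp_convex polyhedron_imp_closed)
  have conic: "conic C" unfolding C_def by (rule conic_conic_hull)
  have dir: "k - w \<in> C" if "k \<in> P" for k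
    unfolding C_def using that by (intro hull_inc) auto
  have "0 \<in> C" using dir[OF w] by simp
  define z where "z = closest_point C x"
  define n where "n = x - z"
  have "z \<in> C" unfolding z_def using C(2) \<open>0 \<in> C\<close> by (intro closest_point_in_set) auto
  have dot: "n \<bullet> (c - z) \<le> 0" if "c \<in> C" for c
    unfolding n_def z_def using C that by (rule closest_point_dot)
  \<comment> \<open>The projection inequality at \<open>0\<close> and at
    \<open>2 *\<^sub>R z\<close> shows that the residual is orthogonal to \<open>z\<close>; hence
    \<open>n\<close> is nonpositive on all of \<open>C\<close>.\<close>
  have "2 *\<^sub>R z \<in> C" using conicD[OF conic \<open>z \<in> C\<close>, of 2] by simp
  then have nz: "n \<bullet> z = 0"
    using dot[OF \<open>0 \<in> C\<close>] dot[of "2 *\<^sub>R z"] by (simp add: inner_diff_right)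
  have nC: "n \<bullet> c \<le> 0" if "c \<in> C" for c
    using dot[OF that] nz by (simp add: inner_diff_right)
  have x: "x = z + n" by (simp add: n_def)
  \<comment> \<open>Since \<open>w' - w\<close> lies in the cone, dropping the residual can only
    increase its inner product with \<open>x\<close>.\<close>
  have "(w' - w) \<bullet> x \<le> (w' - w) \<bullet> z"
    using nC[OF dir[OF w']] by (simp add: x inner_add_right inner_commute)
  also have "\<dots> \<le> norm (w' - w) * norm z" by (rule norm_cauchy_schwarz)
  finally have wz: "(w' - w) \<bullet> x \<le> norm (w' - w) * norm z" .
  with False have "z \<noteq> 0" by auto
  define K where "K = P \<inter> {k. n \<bullet> k = n \<bullet> w}"
  have nP: "n \<bullet> k \<le> n \<bullet> w" if "k \<in> P" for k
    using nC[OF dir[OF that]] by (simp add: inner_diff_right)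
  have K: "K face_of P"
    unfolding K_def using polytope_imp_convex[OF P] nP by (rule face_of_Int_supporting_hyperplane_le)
  have "w \<in> K" using w by (simp add: K_def)
  have Ksub: "K \<subseteq> P" by (simp add: K_def)
  have zK: "z \<in> conic hull ((\<lambda>k. k - w) ` K)"
  proof -
    obtain c k where ck: "0 \<le> c" "k \<in> P" "z = c *\<^sub>R (k - w)"
      using \<open>z \<in> C\<close> by (auto simp: C_def conic_hull_explicit)
    then have "n \<bullet> (k - w) = 0" using nz \<open>z \<noteq> 0\<close> by auto
    then have "k \<in> K" using ck by (simp add: K_def inner_diff_right)
    then show ?thesis using ck by (auto simp: conic_hull_explicit)
  qed
  have fin: "finite (K \<inter> vert P)" using finite_vert[OF P] by simp
  have AP: "A \<subseteq> P" using active_setsD(1)[OF A(1)] vert_subset by blast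
  \<comment> \<open>As \<open>w\<close> maximizes \<open>n\<close> over \<open>P\<close>, every
    point of its active set does too and so lies in the exposed face.\<close>
  have "a \<bullet> n = w \<bullet> n" if "a \<in> A" for a
    using A(1) _ that by (rule active_sets_maximal) (use AP nP in \<open>auto simp: inner_commute\<close>)
  then have AK: "A \<subseteq> K \<inter> vert P"
    using AP active_setsD(1)[OF A(1)] by (auto simp: K_def inner_commute)
  with A(1) have A': "A \<in> active_sets (K \<inter> vert P) w" by (rule active_sets_mono)
  define s where "s = arg_max_on (\<lambda>v. v \<bullet> z) (K \<inter> vert P)"
  have "K \<inter> vert P \<noteq> {}" using AK active_setsD(3)[OF A(1)] by blast
  note s = arg_max_on_finite[OF fin this, where f = "\<lambda>v. v \<bullet> z", folded s_def]
  have "pyr_width P \<le> pyr_dir_width (K \<inter> vert P) z w"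
    using P K \<open>w \<in> K\<close> zK \<open>z \<noteq> 0\<close> by (rule pyr_width_le)
  also have "\<dots> \<le> dir_width (A \<union> {s}) z"
    unfolding s_def using fin A' by (rule pyr_dir_width_le)
  also have "\<dots> \<le> G / norm z"
  proof (rule dir_width_le)
    fix a b assume ab: "a \<in> A \<union> {s}" "b \<in> A \<union> {s}"
    have diff: "(a - b) \<bullet> x = (a - b) \<bullet> z" if "a \<in> K" "b \<in> K" for a b
      using that by (simp add: x K_def inner_simps inner_commute)
    \<comment> \<open>The points of \<open>A\<close> are at level \<open>m\<close> in direction
      \<open>x\<close>, and \<open>s\<close> is between \<open>m\<close> and \<open>m + G\<close>,
      so differences within \<open>A \<union> {s}\<close> are at most \<open>G\<close>.\<close>
    have "m \<le> s \<bullet> x"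
    proof -
      obtain a where "a \<in> A" using active_setsD(3)[OF A(1)] by blast
      then have "(s - a) \<bullet> x \<ge> 0"
        using s AK by (subst diff) (auto simp: inner_diff_left)
      then show ?thesis using A(2)[OF \<open>a \<in> A\<close>] by (simp add: inner_diff_left)
    qed
    moreover have "s \<bullet> x \<le> m + G" using s(1) Ksub by (intro G(2)) auto
    ultimately have "(a - b) \<bullet> x \<le> G"
      using ab A(2) G(1) by (auto simp: inner_diff_left)
    then have "(a - b) \<bullet> z \<le> G" using ab AK s(1) by (subst diff[symmetric]) auto
    then show "(a - b) \<bullet> z / norm z \<le> G / norm z" by (rule divide_right_mono) simp
  qed simp
  finally have "pyr_width P * norm z \<le> G" using \<open>z \<noteq> 0\<close> by (simp add: pos_le_divide_eq)
  then have "pyr_width P * norm z * norm (w' - w) \<le> G * norm (w' - w)"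
    by (rule mult_right_mono) simp
  moreover have "pyr_width P * ((w' - w) \<bullet> x) \<le> pyr_width P * (norm (w' - w) * norm z)"
    using wz pyr_width_bounds(1)[OF P w w' \<open>w \<noteq> w'\<close>] by (intro mult_left_mono) auto
  ultimately show ?thesis by (simp add: mult_ac)
qed

section \<open>Attainment and suboptimality\<close>

lemma is_support_fun_SUP:
  fixes C :: "'a::euclidean_space set"
  assumes "compact C" "C \<noteq> {}"
  shows "is_support_fun C (\<lambda>y. SUP c\<in>C. c \<bullet> y)"
  unfolding is_support_fun_def
proof
  fix y :: 'a
  have "continuous_on C (\<lambda>c. c \<bullet> y)" by (intro continuous_intros)
  from continuous_attains_sup[OF assms this] obtain c
    where c: "c \<in> C" "\<And>c'. c' \<in> C \<Longrightarrow> c' \<bullet> y \<le> c \<bullet> y" by blast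
  then have "(SUP c\<in>C. c \<bullet> y) = c \<bullet> y"
    by (intro cSup_eq_maximum) auto
  then show "(\<forall>c\<in>C. c \<bullet> y \<le> (SUP c\<in>C. c \<bullet> y)) \<and> (\<exists>c\<in>C. c \<bullet> y = (SUP c\<in>C. c \<bullet> y))"
    using c by auto
qed

lemma is_support_fun_convex_hull_MAX:
  fixes S :: "'a::euclidean_space set"
  assumes "finite S" "S \<noteq> {}"
  shows "is_support_fun (convex hull S) (\<lambda>y. MAX c\<in>S. c \<bullet> y)"
  unfolding is_support_fun_def
proof (intro allI conjI ballI)
  fix y :: 'a
  have "(MAX c\<in>S. c \<bullet> y) \<in> (\<lambda>c. c \<bullet> y) ` S"
    using assms by (intro Max_in) auto
  then show "\<exists>c\<in>convex hull S. c \<bullet> y = (MAX c\<in>S. c \<bullet> y)"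
    by (force intro: hull_inc)
  have "convex hull S \<subseteq> {c. y \<bullet> c \<le> (MAX c\<in>S. c \<bullet> y)}"
    using assms by (intro hull_minimal convex_halfspace_le) (auto simp: inner_commute[of y])
  then show "c \<bullet> y \<le> (MAX c\<in>S. c \<bullet> y)" if "c \<in> convex hull S" for c
    using that by (auto simp: inner_commute)
qed

text \<open>The subgradient at \<open>x\<close> yields quadratic growth, so outside a closed ball
  around \<open>x\<close> the objective is at least its value at \<open>x\<close>. On the ball a
  continuous function attains its minimum.\<close>

lemma strongly_convex_plus_support_fun_attains_min:
  fixes g :: "'a::euclidean_space \<Rightarrow> real"
  assumes g: "strongly_convex \<beta> g" and supp: "is_support_fun C \<sigma>"
    and w: "w \<in> C" "\<And>y. g x - w \<bullet> (y - x) \<le> g y"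
  obtains x' where "\<And>y. g x' + \<sigma> x' \<le> g y + \<sigma> y"
proof -
  have "\<beta> > 0" using g by (simp add: strongly_convex_def)
  have growth: "g x + w \<bullet> x + \<beta> / 2 * (norm (y - x))\<^sup>2 \<le> g y + \<sigma> y" for y
  proof -
    have "g x - w \<bullet> (y - x) + \<beta> / 2 * (norm (y - x))\<^sup>2 \<le> g y"
      using strongly_convex_subgradient_bound[OF g, of x "- w" y] w(2) by simp
    then show ?thesis
      using is_support_fun_le[OF supp w(1), of y] by (simp add: inner_diff_right)
  qed
  \<comment> \<open>The radius at which the lower bound \<open>growth\<close> reaches
    \<open>g x + \<sigma> x\<close>.\<close>
  define R where "R = sqrt ((g x + \<sigma> x - (g x + w \<bullet> x)) / (\<beta> / 2))"
  have "0 \<le> g x + \<sigma> x - (g x + w \<bullet> x)" using growth[of x] by simp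
  then have R: "\<beta> / 2 * R\<^sup>2 = g x + \<sigma> x - (g x + w \<bullet> x)" "0 \<le> R"
    using \<open>\<beta> > 0\<close> by (simp_all add: R_def)
  have cont: "continuous_on UNIV (\<lambda>y. g y + \<sigma> y)"
    using strongly_convex_imp_convex_on[OF g] convex_on_support_fun[OF supp]
    by (intro continuous_on_add convex_on_continuous) auto
  have "cball x R \<noteq> {}" using R(2) by simp
  from continuous_attains_inf[OF compact_cball this continuous_on_subset[OF cont subset_UNIV]]
  obtain x' where x': "\<And>y. y \<in> cball x R \<Longrightarrow> g x' + \<sigma> x' \<le> g y + \<sigma> y"
    by blast
  have "g x' + \<sigma> x' \<le> g y + \<sigma> y" for y
  proof (cases "y \<in> cball x R")
    case False
    then have "R < norm (y - x)" by (simp add: dist_norm norm_minus_commute)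
    then have "\<beta> / 2 * R\<^sup>2 \<le> \<beta> / 2 * (norm (y - x))\<^sup>2"
      using R(2) \<open>\<beta> > 0\<close> by (intro mult_left_mono power_mono) auto
    then have "g x + \<sigma> x \<le> g y + \<sigma> y" using growth[of y] R(1) by linarith
    then show ?thesis using x'[of x] R(2) by simp
  qed (rule x')
  then show ?thesis by (rule that)
qed

text \<open>The dual objective is strongly concave, so the squared Frank-Wolfe gap controls the
  suboptimality; the pyramidal width replaces the distance to the dual optimum \<open>w'\<close>.\<close>

lemma pyr_width_suboptimality:
  fixes g :: "'a::euclidean_space \<Rightarrow> real"
  assumes g: "strongly_convex \<beta> g" "smooth_fun \<alpha> g"
    and P: "polytope P" and supp: "is_support_fun P \<sigma>"
    and w: "w \<in> P" "\<And>y. g x - w \<bullet> (y - x) \<le> g y"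
    and A: "A \<in> active_sets (vert P) w" "\<And>a. a \<in> A \<Longrightarrow> a \<bullet> x = w \<bullet> x"
    and \<delta>: "0 \<le> pyr_width P"
  shows "2 * (pyr_width P)\<^sup>2 * ((INF y. g y + \<sigma> y) - (g x + w \<bullet> x))
           \<le> \<alpha> * (\<sigma> x - w \<bullet> x)\<^sup>2"
proof -
  define \<delta> where "\<delta> = pyr_width P"
  define G where "G = \<sigma> x - w \<bullet> x"
  have "\<alpha> > 0" using g(2) by (simp add: smooth_fun_def)
  have G: "0 \<le> G" "\<And>k. k \<in> P \<Longrightarrow> k \<bullet> x \<le> w \<bullet> x + G"
    using is_support_fun_le[OF supp] w(1) by (auto simp: G_def)
  obtain x' where x': "\<And>y. g x' + \<sigma> x' \<le> g y + \<sigma> y"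
    using strongly_convex_plus_support_fun_attains_min[OF g(1) supp w] by blast
  obtain w' where w': "w' \<in> P" "w' \<bullet> x' = \<sigma> x'" "\<And>y. g x' - w' \<bullet> (y - x') \<le> g y"
    using support_fun_minimizer_dual[OF supp polytope_imp_convex[OF P] polytope_imp_closed[OF P]
        strongly_convex_imp_convex_on[OF g(1)] x'] by blast
  define D where "D = (INF y. g y + \<sigma> y) - (g x + w \<bullet> x)"
  define s where "s = norm (w' - w)"
  have "(INF y. g y + \<sigma> y) \<le> g x' + \<sigma> x'"
    by (rule cINF_lower) (use x' in \<open>auto intro!: bdd_belowI2\<close>)
  moreover have "g x' - w' \<bullet> (x - x') + s\<^sup>2 / (2 * \<alpha>) \<le> g x"
    using smooth_fun_cocoercive[OF g(2), of x "- w" x' "- w'"] w(2) w'(3)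
    by (simp add: s_def norm_minus_commute)
  ultimately have "D \<le> (w' - w) \<bullet> x - s\<^sup>2 / (2 * \<alpha>)"
    using w'(2) by (simp add: D_def inner_diff_left inner_diff_right)
  \<comment> \<open>The scaling lets \<open>pyr_width_gap\<close> replace
    \<open>\<delta> * ((w' - w) \<bullet> x)\<close> by \<open>G * s\<close>; completing the square
    then eliminates the unknown distance \<open>s\<close>.\<close>
  then have "2 * \<alpha> * \<delta>\<^sup>2 * D \<le> 2 * \<alpha> * \<delta>\<^sup>2 * ((w' - w) \<bullet> x - s\<^sup>2 / (2 * \<alpha>))"
    using \<open>\<alpha> > 0\<close> by (intro mult_left_mono) auto
  also have "\<dots> = 2 * \<alpha> * \<delta> * (\<delta> * ((w' - w) \<bullet> x)) - (\<delta> * s)\<^sup>2"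
    using \<open>\<alpha> > 0\<close> by (simp add: field_simps power2_eq_square)
  also have "\<dots> \<le> 2 * \<alpha> * \<delta> * (G * s) - (\<delta> * s)\<^sup>2"
    using pyr_width_gap[OF P w(1) w'(1) A G] \<open>\<alpha> > 0\<close> \<delta> G
    by (intro diff_right_mono mult_left_mono) (auto simp: \<delta>_def s_def)
  also have "\<dots> \<le> (\<alpha> * G)\<^sup>2"
    using zero_le_power2[of "\<alpha> * G - \<delta> * s"] by (simp add: power2_diff mult_ac)
  finally have "\<alpha> * (2 * \<delta>\<^sup>2 * D) \<le> \<alpha> * (\<alpha> * G\<^sup>2)"
    by (simp add: power_mult_distrib power2_eq_square mult_ac)
  then show ?thesis
    using \<open>\<alpha> > 0\<close> by (simp add: D_def G_def \<delta>_def)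
qed

section \<open>Optimizing over the step length\<close>

lemma le_of_forall_quadratic_le:
  fixes G D K :: real
  assumes "\<And>t. 0 \<le> t \<Longrightarrow> t \<le> 1 \<Longrightarrow> t * G - t\<^sup>2 * K \<le> D" and "D < K"
  shows "G \<le> 2 * sqrt (K * D)"
proof (cases "G \<le> 0")
  case False
  have "0 \<le> D" using assms(1)[of 0] by simp
  then have "K > 0" using assms(2) by simp
  \<comment> \<open>The quadratic in \<open>t\<close> peaks at \<open>G / (2 * K)\<close> with value
    \<open>G\<^sup>2 / (4 * K)\<close>. The step \<open>t = 1\<close> gives
    \<open>G \<le> D + K < 2 * K\<close>, so the peak is admissible.\<close>
  have "G / (2 * K) \<le> 1"
    using assms(1)[of 1] assms(2) \<open>K > 0\<close> by simp
  then have "G / (2 * K) * G - (G / (2 * K))\<^sup>2 * K \<le> D"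
    using False \<open>K > 0\<close> by (intro assms(1)) auto
  then have "G\<^sup>2 \<le> 4 * (K * D)"
    using \<open>K > 0\<close> by (simp add: power2_eq_square field_simps)
  then have "G \<le> sqrt (4 * (K * D))" by (rule real_le_rsqrt)
  then show ?thesis by (simp add: real_sqrt_mult)
next
  case True
  have "0 \<le> K * D" using assms(1)[of 0] assms(2) by simp
  with True show ?thesis by (meson mult_nonneg_nonneg order_trans real_sqrt_ge_zero zero_le_numeral)
qed

text \<open>If \<open>G \<le> 2 * K\<close>, the optimal step \<open>G / (2 * K)\<close> decreases
  \<open>D\<close> by at least \<open>4 * \<rho> * D\<close>. Otherwise the full step gains
  \<open>G - K\<close>, which exceeds \<open>G / 2\<close> and thus
  \<open>\<rho> * D\<close>.\<close>

lemma contraction_of_forall_quadratic_le: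
  fixes G D D' K \<rho> :: real
  assumes step: "\<And>t. 0 \<le> t \<Longrightarrow> t \<le> 1 \<Longrightarrow> D' \<le> D - (t * G - t\<^sup>2 * K)"
    and K: "0 < K" and D: "0 \<le> D" "D \<le> G" "16 * \<rho> * K * D \<le> G\<^sup>2" and \<rho>: "0 \<le> \<rho>" "\<rho> \<le> 1 / 4"
  shows "D' \<le> (1 - \<rho>) * D"
proof (cases "G \<le> 2 * K")
  case True
  have "0 \<le> \<rho> * D" using D \<rho> by simp
  have "4 * (\<rho> * D) \<le> G\<^sup>2 / (4 * K)"
    using D(3) K by (simp add: field_simps)
  also have "G\<^sup>2 / (4 * K) = G / (2 * K) * G - (G / (2 * K))\<^sup>2 * K"
    using K by (simp add: power2_eq_square field_simps)
  finally have "D' \<le> D - 4 * (\<rho> * D)"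
    using step[of "G / (2 * K)"] True K D by simp
  then show ?thesis using \<open>0 \<le> \<rho> * D\<close> by (simp add: left_diff_distrib)
next
  case False
  have "\<rho> * D \<le> 1 / 4 * D" using \<rho> D by (intro mult_right_mono)
  then show ?thesis using step[of 1] False D by (simp add: left_diff_distrib)
qed

section \<open>Runs of L-KM\<close>

lemma polytope_base_polytope:
  fixes F :: "'n::finite set \<Rightarrow> real"
  shows "polytope (base_polytope F)"
proof -
  define e :: "'n set \<Rightarrow> real ^ 'n" where "e A = (\<Sum>k\<in>A. axis k 1)" for A
  have e: "e A \<bullet> w = (\<Sum>k\<in>A. w $ k)" for A w
    by (simp add: e_def inner_sum_left inner_axis')
  have eq: "base_polytope F = (\<Inter>A. {w. e A \<bullet> w \<le> F A}) \<inter> {w. e UNIV \<bullet> w = F UNIV}"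
    by (auto simp: base_polytope_def e)
  have "polyhedron (base_polytope F)"
    unfolding eq by (intro polyhedron_Int polyhedron_Inter polyhedron_hyperplane)
      (auto intro: polyhedron_halfspace_le)
  \<comment> \<open>The constraints for singletons bound the coordinates above; those for their
    complements, subtracted from the total, bound them below.\<close>
  moreover have "base_polytope F \<subseteq> cbox (\<chi> k. F UNIV - F (UNIV - {k})) (\<chi> k. F {k})"
  proof
    fix w assume w: "w \<in> base_polytope F"
    have "F UNIV - F (UNIV - {k}) \<le> w $ k \<and> w $ k \<le> F {k}" for k
    proof -
      have "(\<Sum>j\<in>{k}. w $ j) \<le> F {k}" "(\<Sum>j\<in>UNIV - {k}. w $ j) \<le> F (UNIV - {k})"
        "(\<Sum>j\<in>UNIV. w $ j) = F UNIV"
        using w unfolding base_polytope_def by blast+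
      moreover have "(\<Sum>j\<in>UNIV. w $ j) = w $ k + (\<Sum>j\<in>UNIV - {k}. w $ j)"
        by (rule sum.remove) auto
      ultimately show ?thesis by simp
    qed
    then show "w \<in> cbox (\<chi> k. F UNIV - F (UNIV - {k})) (\<chi> k. F {k})"
      by (simp add: mem_box_cart)
  qed
  ultimately show ?thesis
    unfolding polytope_eq_bounded_polyhedron by (blast intro: bounded_subset bounded_cbox)
qed

lemma is_support_fun_lovasz_extension:
  "base_polytope F \<noteq> {} \<Longrightarrow> is_support_fun (base_polytope F) (lovasz_extension F)"
  unfolding lovasz_extension_def[abs_def]
  by (rule is_support_fun_SUP[OF polytope_imp_compact[OF polytope_base_polytope]])

section \<open>Invariants of a run and its dual iterates\<close>

lemma lkm_performed_SucD:
  assumes "lkm_performed g F \<epsilon> V x (Suc i)" "i \<ge> 1"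
  shows "lkm_performed g F \<epsilon> V x i" "\<not> lkm_p g F x i - lkm_d g V x i \<le> \<epsilon>"
  using assms by (auto simp: lkm_performed_def)

lemma lkm_run_V_Suc:
  assumes "lkm_run g F \<epsilon> V x v" "lkm_performed g F \<epsilon> V x (Suc i)" "i \<ge> 1"
  shows "V i = lkm_active V x i \<union> {v i}"
  using assms(1) lkm_performed_SucD[OF assms(2,3)] by (auto simp: lkm_run_def)

lemma lkm_run_V:
  assumes run: "lkm_run g F \<epsilon> V x v" and "lkm_performed g F \<epsilon> V x i"
  shows "V (i - 1) \<noteq> {}" "V (i - 1) \<subseteq> vert (base_polytope F)"
proof -
  have "1 \<le> i" using assms(2) by (simp add: lkm_performed_def)
  then have "V (i - 1) \<noteq> {} \<and> V (i - 1) \<subseteq> vert (base_polytope F)"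
    using assms(2)
  proof (induction i rule: dec_induct)
    case base
    then show ?case using run by (simp add: lkm_run_def)
  next
    \<comment> \<open>The update keeps only old elements and adds the vertex \<open>v i\<close>,
      which also makes the new set nonempty.\<close>
    case (step i)
    note perf = lkm_performed_SucD[OF step.prems step.hyps(1)]
    have "v i \<in> vert (base_polytope F)" using run perf by (auto simp: lkm_run_def)
    then show ?case
      using step.IH[OF perf(1)] lkm_run_V_Suc[OF run step.prems step.hyps(1)]
      by (auto simp: lkm_active_def)
  qed
  then show "V (i - 1) \<noteq> {}" "V (i - 1) \<subseteq> vert (base_polytope F)" by auto
qed

lemma is_support_fun_lkm_model:
  assumes "lkm_run g F \<epsilon> V x v" "lkm_performed g F \<epsilon> V x i"
  shows "is_support_fun (convex hull V (i - 1)) (lkm_model V i)"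
  unfolding lkm_model_def[abs_def]
  using lkm_run_V[OF assms] finite_vert[OF polytope_base_polytope, of F]
  by (intro is_support_fun_convex_hull_MAX) (auto intro: finite_subset)

text \<open>The optimality condition for \<open>x i\<close>: the point \<open>w\<close> is the dual
  iterate, and its dual value, the infimum of \<open>g y + w \<bullet> y\<close> over
  \<open>y\<close>, is \<open>lkm_d g V x i\<close>.\<close>

lemma lkm_dual_point:
  assumes run: "lkm_run g F \<epsilon> V x v" and perf: "lkm_performed g F \<epsilon> V x i"
    and g: "strongly_convex \<beta> g"
  obtains w where "w \<in> convex hull V (i - 1)" "w \<bullet> x i = lkm_model V i (x i)"
    "\<And>y. g (x i) - w \<bullet> (y - x i) \<le> g y"
proof (rule support_fun_minimizer_dual[OF is_support_fun_lkm_model[OF run perf]])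
  have "finite (V (i - 1))"
    using lkm_run_V(2)[OF run perf] finite_vert[OF polytope_base_polytope] by (rule finite_subset)
  then show "closed (convex hull V (i - 1))"
    by (intro compact_imp_closed finite_imp_compact_convex_hull)
  show "g (x i) + lkm_model V i (x i) \<le> g y + lkm_model V i y" for y
    using run perf by (auto simp: lkm_run_def is_arg_min_def not_less)
  show "convex_on UNIV g" using g by (rule strongly_convex_imp_convex_on)
qed (use that in auto)

lemma lkm_vertex:
  assumes run: "lkm_run g F \<epsilon> V x v" and perf: "lkm_performed g F \<epsilon> V x i"
  shows "v i \<in> base_polytope F" "v i \<bullet> x i = lovasz_extension F (x i)"
proof -
  have v: "v i \<in> base_polytope F" "\<And>w. w \<in> base_polytope F \<Longrightarrow> w \<bullet> x i \<le> v i \<bullet> x i"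
    using run perf by (auto simp: lkm_run_def is_arg_max_linorder)
  then have supp: "is_support_fun (base_polytope F) (lovasz_extension F)"
    by (intro is_support_fun_lovasz_extension) auto
  then obtain c where "c \<in> base_polytope F" "c \<bullet> x i = lovasz_extension F (x i)"
    by (rule is_support_funE)
  then show "v i \<bullet> x i = lovasz_extension F (x i)"
    using v(2) is_support_fun_le[OF supp v(1), of "x i"] by fastforce
  show "v i \<in> base_polytope F" by (rule v(1))
qed

lemma convex_hull_V_subset:
  assumes "lkm_run g F \<epsilon> V x v" "lkm_performed g F \<epsilon> V x i"
  shows "convex hull V (i - 1) \<subseteq> base_polytope F"
  using lkm_run_V(2)[OF assms] convex_hull_vert[OF polytope_base_polytope, of F] hull_mono by metis

text \<open>The two relevant choices of \<open>\<sigma>\<close> are the Lovasz extension and the next model.\<close>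

lemma lkm_quadratic_step:
  assumes run: "lkm_run g F \<epsilon> V x v" and perf: "lkm_performed g F \<epsilon> V x i"
    and g: "strongly_convex \<beta> g"
    and w: "w \<in> convex hull V (i - 1)" "w \<bullet> x i = lkm_model V i (x i)"
      "\<And>y. g (x i) - w \<bullet> (y - x i) \<le> g y"
    and t: "0 \<le> t" "t \<le> 1"
    and supp: "is_support_fun C \<sigma>" "convex C" "w \<in> C" "v i \<in> C"
  shows "lkm_d g V x i + (t * (lkm_p g F x i - lkm_d g V x i)
           - t\<^sup>2 * ((diameter (base_polytope F))\<^sup>2 / (2 * \<beta>))) \<le> g y + \<sigma> y"
proof -
  have "norm (v i - w) \<le> diameter (base_polytope F)"
    unfolding dist_norm[symmetric]
    using lkm_vertex(1)[OF run perf] w(1) convex_hull_V_subset[OF run perf]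
    by (intro diameter_bounded_bound polytope_imp_bounded polytope_base_polytope) auto
  from strongly_convex_dual_bound[OF g w(3) this, of t y]
  have "lkm_d g V x i + t * ((v i - w) \<bullet> x i) - t\<^sup>2 * ((diameter (base_polytope F))\<^sup>2 / (2 * \<beta>))
      \<le> g y + ((1 - t) *\<^sub>R w + t *\<^sub>R v i) \<bullet> y"
    by (simp add: lkm_d_def w(2))
  moreover have "(v i - w) \<bullet> x i = lkm_p g F x i - lkm_d g V x i"
    using lkm_vertex(2)[OF run perf] w(2) by (simp add: lkm_p_def lkm_d_def inner_diff_left)
  moreover have "(1 - t) *\<^sub>R w + t *\<^sub>R v i \<in> C"
    using supp(2-4) t by (intro convexD) auto
  then have "((1 - t) *\<^sub>R w + t *\<^sub>R v i) \<bullet> y \<le> \<sigma> y"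
    by (rule is_support_fun_le[OF supp(1)])
  ultimately show ?thesis by simp
qed

section \<open>Gap bounds and contraction of the dual suboptimality\<close>

lemma lkm_gap_bounds:
  assumes run: "lkm_run g F \<epsilon> V x v" and perf: "lkm_performed g F \<epsilon> V x i"
    and g: "strongly_convex \<beta> g"
  shows "0 \<le> t \<Longrightarrow> t \<le> 1 \<Longrightarrow> t * (lkm_p g F x i - lkm_d g V x i)
           - t\<^sup>2 * ((diameter (base_polytope F))\<^sup>2 / (2 * \<beta>)) \<le> opt_value g F - lkm_d g V x i"
    and "opt_value g F \<le> lkm_p g F x i"
proof -
  let ?P = "base_polytope F"
  have v: "v i \<in> ?P" using lkm_vertex[OF run perf] by simp
  then have supp: "is_support_fun ?P (lovasz_extension F)"
    by (intro is_support_fun_lovasz_extension) auto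
  obtain w where w: "w \<in> convex hull V (i - 1)" "w \<bullet> x i = lkm_model V i (x i)"
    "\<And>y. g (x i) - w \<bullet> (y - x i) \<le> g y"
    using lkm_dual_point[OF run perf g] by blast
  have wP: "w \<in> ?P" using w(1) convex_hull_V_subset[OF run perf] by blast
  have *: "lkm_d g V x i + (t * (lkm_p g F x i - lkm_d g V x i)
           - t\<^sup>2 * ((diameter ?P)\<^sup>2 / (2 * \<beta>))) \<le> g y + lovasz_extension F y"
    if "0 \<le> t" "t \<le> 1" for t y
    using run perf g w that supp polytope_imp_convex[OF polytope_base_polytope] wP v
    by (rule lkm_quadratic_step)
  show "t * (lkm_p g F x i - lkm_d g V x i) - t\<^sup>2 * ((diameter ?P)\<^sup>2 / (2 * \<beta>))
      \<le> opt_value g F - lkm_d g V x i" if "0 \<le> t" "t \<le> 1"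
  proof -
    have "lkm_d g V x i + (t * (lkm_p g F x i - lkm_d g V x i)
           - t\<^sup>2 * ((diameter ?P)\<^sup>2 / (2 * \<beta>))) \<le> opt_value g F"
      unfolding opt_value_def using *[OF that] by (intro cINF_greatest) auto
    then show ?thesis by simp
  qed
  \<comment> \<open>The step \<open>t = 0\<close> bounds the objective below by
    \<open>lkm_d g V x i\<close>, so the infimum defining \<open>opt_value\<close> is a genuine
    lower bound.\<close>
  show "opt_value g F \<le> lkm_p g F x i"
    unfolding opt_value_def lkm_p_def
    by (rule cINF_lower) (use *[of 0] in \<open>auto intro!: bdd_belowI2\<close>)
qed

lemma lkm_linear_convergence:
  fixes F :: "'n::finite set \<Rightarrow> real"
  assumes run: "lkm_run g F \<epsilon> V x v"
    and perf: "lkm_performed g F \<epsilon> V x i" "lkm_performed g F \<epsilon> V x (i + 1)" "i \<ge> 1"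
    and g: "strongly_convex \<beta> g" "smooth_fun \<alpha> g"
    and \<delta>: "0 < pyr_width (base_polytope F)" and M: "0 < diameter (base_polytope F)"
    and \<rho>: "\<rho> = \<beta> / (4 * \<alpha>) * (pyr_width (base_polytope F) / diameter (base_polytope F))\<^sup>2"
      "\<rho> \<le> 1 / 4"
  shows "opt_value g F - lkm_d g V x (i + 1) \<le> (1 - \<rho>) * (opt_value g F - lkm_d g V x i)"
proof (rule contraction_of_forall_quadratic_le[where G = "lkm_p g F x i - lkm_d g V x i"
      and K = "(diameter (base_polytope F))\<^sup>2 / (2 * \<beta>)"])
  let ?P = "base_polytope F"
  define K where "K = (diameter ?P)\<^sup>2 / (2 * \<beta>)"
  define G where "G = lkm_p g F x i - lkm_d g V x i"
  define D where "D = opt_value g F - lkm_d g V x i"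
  have "\<beta> > 0" "\<alpha> > 0" using g by (auto simp: strongly_convex_def smooth_fun_def)
  then show "0 < (diameter ?P)\<^sup>2 / (2 * \<beta>)" "0 \<le> \<rho>" "\<rho> \<le> 1 / 4"
    using M \<rho> by (auto intro!: divide_pos_pos)
  show "0 \<le> opt_value g F - lkm_d g V x i"
    using lkm_gap_bounds(1)[OF run perf(1) g(1), of 0] by simp
  show "opt_value g F - lkm_d g V x i \<le> lkm_p g F x i - lkm_d g V x i"
    using lkm_gap_bounds(2)[OF run perf(1) g(1)] by simp
  obtain w where w: "w \<in> convex hull V (i - 1)" "w \<bullet> x i = lkm_model V i (x i)"
    "\<And>y. g (x i) - w \<bullet> (y - x i) \<le> g y"
    using lkm_dual_point[OF run perf(1) g(1)] by blast
  have wP: "w \<in> ?P" using w(1) convex_hull_V_subset[OF run perf(1)] by blast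
  have fin: "finite (V (i - 1))"
    using lkm_run_V(2)[OF run perf(1)] finite_vert[OF polytope_base_polytope] by (rule finite_subset)
  obtain A where A: "A \<in> active_sets (V (i - 1)) w"
    using active_sets_nonempty[OF fin w(1)] .
  note A' = active_setsD[OF A]
  \<comment> \<open>The dual iterate attains the maximum of the model, so each vertex with positive
    weight in its representation is active.\<close>
  have Amax: "a \<bullet> x i = w \<bullet> x i" if "a \<in> A" for a
  proof (rule active_sets_maximal[OF A _ that])
    fix b assume "b \<in> A"
    then have "b \<in> convex hull V (i - 1)" using A'(1) by (auto intro: hull_inc)
    then show "b \<bullet> x i \<le> w \<bullet> x i"
      unfolding w(2) by (rule is_support_fun_le[OF is_support_fun_lkm_model[OF run perf(1)]])
  qed
  have AV: "A \<in> active_sets (vert ?P) w"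
    using A A'(1) lkm_run_V(2)[OF run perf(1)] by (intro active_sets_mono[OF A]) auto
  have supp: "is_support_fun ?P (lovasz_extension F)"
    using wP by (intro is_support_fun_lovasz_extension) auto
  have G: "G = lovasz_extension F (x i) - w \<bullet> x i"
    by (simp add: G_def lkm_p_def lkm_d_def w(2))
  have D: "D = (INF y. g y + lovasz_extension F y) - (g (x i) + w \<bullet> x i)"
    by (simp add: D_def opt_value_def lkm_d_def w(2))
  have "2 * (pyr_width ?P)\<^sup>2 * D \<le> \<alpha> * G\<^sup>2"
    unfolding D G
    using g polytope_base_polytope supp wP w(3) AV Amax \<delta>[THEN less_imp_le]
    by (rule pyr_width_suboptimality)
  then have "2 * (pyr_width ?P)\<^sup>2 * D / \<alpha> \<le> G\<^sup>2"
    using \<open>\<alpha> > 0\<close> by (simp only: pos_divide_le_eq mult.commute[of "G\<^sup>2"])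
  \<comment> \<open>The constants in \<open>\<rho>\<close> and \<open>K\<close> cancel so that the
    pyramidal bound becomes the hypothesis of the contraction lemma.\<close>
  moreover have "16 * \<rho> * K = 2 * (pyr_width ?P)\<^sup>2 / \<alpha>"
    using \<open>\<beta> > 0\<close> \<open>\<alpha> > 0\<close> M by (simp add: \<rho>(1) K_def power_divide)
  ultimately show "16 * \<rho> * ((diameter ?P)\<^sup>2 / (2 * \<beta>)) * (opt_value g F - lkm_d g V x i)
      \<le> (lkm_p g F x i - lkm_d g V x i)\<^sup>2"
    unfolding K_def[symmetric] D_def[symmetric] G_def[symmetric] by simp
  fix t :: real assume t: "0 \<le> t" "t \<le> 1"
  have V: "V i = lkm_active V x i \<union> {v i}"
    using lkm_run_V_Suc[OF run] perf by simp
  \<comment> \<open>Discarding inactive vertices preserves the representation of \<open>w\<close>,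
    so the whole segment from \<open>w\<close> to \<open>v i\<close> is available to the next
    model.\<close>
  have "A \<subseteq> V i"
    using A'(1) Amax w(2) by (auto simp: V lkm_active_def)
  then have "w \<in> convex hull V i"
    using A'(4) hull_mono[of A "V i" convex] by blast
  moreover have "v i \<in> convex hull V i"
    by (rule hull_inc) (simp add: V)
  moreover have "is_support_fun (convex hull V i) (lkm_model V (i + 1))"
    using is_support_fun_lkm_model[OF run perf(2)] by simp
  ultimately have "lkm_d g V x i + (t * (lkm_p g F x i - lkm_d g V x i)
      - t\<^sup>2 * ((diameter ?P)\<^sup>2 / (2 * \<beta>))) \<le> lkm_d g V x (i + 1)"
    unfolding lkm_d_def[of g V x "i + 1"]
    using lkm_quadratic_step[OF run perf(1) g(1) w t _ convex_convex_hull] by blast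
  then show "opt_value g F - lkm_d g V x (i + 1) \<le> opt_value g F - lkm_d g V x i
      - (t * (lkm_p g F x i - lkm_d g V x i) - t\<^sup>2 * ((diameter ?P)\<^sup>2 / (2 * \<beta>)))"
    unfolding diff_diff_eq by (rule diff_left_mono)
qed

text \<open>The last conjunct makes linear convergence of the gap explicit. In the small regime the
  gap is controlled by the square root of \<open>pstar - d i\<close>, whence the factor
  \<open>sqrt (1 - \<rho>)\<close>; the maximum covers both regimes.\<close>

theorem theorem6p3:
  fixes F :: "'n::finite set \<Rightarrow> real" and g :: "real ^ 'n \<Rightarrow> real"
    and \<beta> \<epsilon> M pstar :: real
    and V :: "nat \<Rightarrow> (real ^ 'n) set" and x v :: "nat \<Rightarrow> real ^ 'n"
    and p d :: "nat \<Rightarrow> real"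
  assumes "submodular F" and "F {} = 0"
    and "strongly_convex \<beta> g"
    and "\<epsilon> \<ge> 0" and "lkm_run g F \<epsilon> V x v"
  defines "M \<equiv> diameter (base_polytope F)"
    and "pstar \<equiv> opt_value g F"
    and "p \<equiv> lkm_p g F x"
    and "d \<equiv> lkm_d g V x"
  shows "(\<forall>i. lkm_performed g F \<epsilon> V x i \<longrightarrow>
            (pstar - d i \<ge> M\<^sup>2 / (2 * \<beta>) \<longrightarrow>
               p i - d i \<le> (pstar - d i) + M\<^sup>2 / (2 * \<beta>)) \<and>
            (\<not> pstar - d i \<ge> M\<^sup>2 / (2 * \<beta>) \<longrightarrow>
               p i - d i \<le> M * sqrt (2 * (pstar - d i) / \<beta>))) \<and>
         (\<forall>\<alpha> \<delta> \<rho>. smooth_fun \<alpha> g \<longrightarrow> \<not> (\<exists>b. base_polytope F = {b}) \<longrightarrow>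
            \<delta> = pyr_width (base_polytope F) \<longrightarrow> \<rho> = \<beta> / (4 * \<alpha>) * (\<delta> / M)\<^sup>2 \<longrightarrow>
            0 < \<rho> \<and> \<rho> < 1 \<and>
            (\<forall>i\<ge>1. lkm_performed g F \<epsilon> V x i \<and> lkm_performed g F \<epsilon> V x (i + 1) \<longrightarrow>
               pstar - d (i + 1) \<le> (1 - \<rho>) * (pstar - d i)) \<and>
            (\<forall>i. lkm_performed g F \<epsilon> V x i \<longrightarrow>
               p i - d i \<le> max (2 * (pstar - d 1)) (M * sqrt (2 * (pstar - d 1) / \<beta>))
                             * sqrt (1 - \<rho>) ^ (i - 1)))"
proof -
  let ?P = "base_polytope F"
  define K where "K = M\<^sup>2 / (2 * \<beta>)"
  have "\<beta> > 0" using assms(3) by (simp add: strongly_convex_def)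
  have "0 \<le> K" using \<open>\<beta> > 0\<close> by (simp add: K_def)
  have "0 \<le> M"
    unfolding M_def by (intro diameter_ge_0 polytope_imp_bounded polytope_base_polytope)
  note run = \<open>lkm_run g F \<epsilon> V x v\<close>
  have quad: "t * (p i - d i) - t\<^sup>2 * K \<le> pstar - d i"
    if "lkm_performed g F \<epsilon> V x i" "0 \<le> t" "t \<le> 1" for i t
    using lkm_gap_bounds(1)[OF run that(1) assms(3) that(2,3)]
    by (simp add: K_def M_def p_def d_def pstar_def)
  have D_nonneg: "0 \<le> pstar - d i" if "lkm_performed g F \<epsilon> V x i" for i
    using quad[OF that, of 0] by simp
  have large: "p i - d i \<le> (pstar - d i) + K" if "lkm_performed g F \<epsilon> V x i" for i
    using quad[OF that, of 1] by simp
  have sqrt_eq: "2 * sqrt (K * D) = M * sqrt (2 * D / \<beta>)" for D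
  proof -
    have "2 * sqrt (K * D) = sqrt (2\<^sup>2 * (K * D))" by (simp only: real_sqrt_mult) simp
    also have "2\<^sup>2 * (K * D) = M\<^sup>2 * (2 * D / \<beta>)" by (simp add: K_def)
    also have "sqrt \<dots> = sqrt (M\<^sup>2) * sqrt (2 * D / \<beta>)" by (rule real_sqrt_mult)
    finally show ?thesis using \<open>0 \<le> M\<close> by simp
  qed
  have small: "p i - d i \<le> M * sqrt (2 * (pstar - d i) / \<beta>)"
    if "lkm_performed g F \<epsilon> V x i" "pstar - d i < K" for i
    unfolding sqrt_eq[symmetric] using quad[OF that(1)] that(2) by (rule le_of_forall_quadratic_le)
  have "0 < \<rho> \<and> \<rho> < 1 \<and>
      (\<forall>i\<ge>1. lkm_performed g F \<epsilon> V x i \<and> lkm_performed g F \<epsilon> V x (i + 1) \<longrightarrow>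
         pstar - d (i + 1) \<le> (1 - \<rho>) * (pstar - d i)) \<and>
      (\<forall>i. lkm_performed g F \<epsilon> V x i \<longrightarrow>
         p i - d i \<le> max (2 * (pstar - d 1)) (M * sqrt (2 * (pstar - d 1) / \<beta>))
                       * sqrt (1 - \<rho>) ^ (i - 1))"
    if smooth: "smooth_fun \<alpha> g" and single: "\<not> (\<exists>b. ?P = {b})" and \<delta>: "\<delta> = pyr_width ?P"
      and \<rho>: "\<rho> = \<beta> / (4 * \<alpha>) * (\<delta> / M)\<^sup>2" for \<alpha> \<delta> \<rho>
  proof (intro conjI)
    have "\<alpha> > 0" using smooth by (simp add: smooth_fun_def)
    have "lkm_performed g F \<epsilon> V x 1" by (auto simp: lkm_performed_def)
    then have "v 1 \<in> ?P" by (rule lkm_vertex(1)[OF run])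
    \<comment> \<open>The run supplies one point of the polytope, which excludes the empty set, so a
      polytope that is no singleton has a second point.\<close>
    then obtain b where "b \<in> ?P" "v 1 \<noteq> b" using single by blast
    note \<delta>_bounds = pyr_width_bounds[OF polytope_base_polytope \<open>v 1 \<in> ?P\<close> this, folded \<delta> M_def]
    then have "M > 0" by simp
    have "\<delta> / M \<le> 1" using \<delta>_bounds by simp
    then have "(\<delta> / M)\<^sup>2 \<le> 1" using \<delta>_bounds(1) \<open>M > 0\<close> by (intro power_le_one) auto
    moreover have "\<beta> / (4 * \<alpha>) \<le> 1 / 4"
      using strongly_convex_smooth_le[OF assms(3) smooth] \<open>\<alpha> > 0\<close> by simp
    ultimately have "\<rho> \<le> 1 / 4 * 1"
      unfolding \<rho> by (intro mult_mono) auto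
    then have \<rho>_le: "\<rho> \<le> 1 / 4" by simp
    then show "\<rho> < 1" by simp
    show "0 < \<rho>" using \<delta>_bounds(1) \<open>M > 0\<close> \<open>\<alpha> > 0\<close> \<open>\<beta> > 0\<close> by (simp add: \<rho>)
    have contract: "pstar - d (i + 1) \<le> (1 - \<rho>) * (pstar - d i)"
      if "i \<ge> 1" "lkm_performed g F \<epsilon> V x i" "lkm_performed g F \<epsilon> V x (i + 1)" for i
      using lkm_linear_convergence[OF run that(2,3,1) assms(3) smooth] \<delta>_bounds(1) \<open>M > 0\<close> \<rho> \<rho>_le
      by (simp add: \<delta> M_def d_def pstar_def)
    then show "\<forall>i\<ge>1. lkm_performed g F \<epsilon> V x i \<and> lkm_performed g F \<epsilon> V x (i + 1) \<longrightarrow>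
        pstar - d (i + 1) \<le> (1 - \<rho>) * (pstar - d i)" by blast
    have rate: "pstar - d i \<le> (1 - \<rho>) ^ (i - 1) * (pstar - d 1)"
      if "i \<ge> 1" "lkm_performed g F \<epsilon> V x i" for i
      using that
    proof (induction i rule: dec_induct)
      case (step i)
      note perf = lkm_performed_SucD(1)[OF step.prems step.hyps(1)]
      have "pstar - d (Suc i) \<le> (1 - \<rho>) * (pstar - d i)"
        using contract[of i] step.hyps(1) perf step.prems by simp
      also have "\<dots> \<le> (1 - \<rho>) * ((1 - \<rho>) ^ (i - 1) * (pstar - d 1))"
        using step.IH[OF perf] \<open>\<rho> < 1\<close> by (intro mult_left_mono) auto
      also have "\<dots> = (1 - \<rho>) ^ (Suc i - 1) * (pstar - d 1)"
        using step.hyps(1) by (cases i) auto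
      finally show ?case .
    qed simp
    show "\<forall>i. lkm_performed g F \<epsilon> V x i \<longrightarrow>
        p i - d i \<le> max (2 * (pstar - d 1)) (M * sqrt (2 * (pstar - d 1) / \<beta>)) * sqrt (1 - \<rho>) ^ (i - 1)"
      (is "\<forall>i. _ \<longrightarrow> _ \<le> ?m * _")
    proof (intro allI impI)
      fix i assume perf: "lkm_performed g F \<epsilon> V x i"
      then have "i \<ge> 1" by (simp add: lkm_performed_def)
      define r where "r = sqrt (1 - \<rho>) ^ (i - 1)"
      have "0 \<le> sqrt (1 - \<rho>)" "sqrt (1 - \<rho>) \<le> 1" using \<open>\<rho> < 1\<close> \<open>0 < \<rho>\<close> by auto
      then have r: "0 \<le> r" "r \<le> 1" unfolding r_def by (auto intro: power_le_one)
      have r2: "(1 - \<rho>) ^ (i - 1) = r\<^sup>2"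
      proof -
        have "r\<^sup>2 = (sqrt (1 - \<rho>))\<^sup>2 ^ (i - 1)"
          unfolding r_def power_mult[symmetric] by (simp only: mult.commute)
        then show ?thesis using \<open>\<rho> < 1\<close> by simp
      qed
      have D1: "0 \<le> pstar - d 1" by (rule D_nonneg) fact
      have Di: "pstar - d i \<le> r\<^sup>2 * (pstar - d 1)" using rate[OF \<open>i \<ge> 1\<close> perf] unfolding r2 .
      have "p i - d i \<le> ?m * r"
      proof (cases "pstar - d i < K")
        case True
        have "p i - d i \<le> M * sqrt (2 * (pstar - d i) / \<beta>)" using small[OF perf True] .
        also have "\<dots> \<le> M * sqrt (r\<^sup>2 * (2 * (pstar - d 1) / \<beta>))"
        proof (intro mult_left_mono real_sqrt_le_mono)
          have "2 * (pstar - d i) / \<beta> \<le> 2 * (r\<^sup>2 * (pstar - d 1)) / \<beta>"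
            using Di \<open>\<beta> > 0\<close> by (intro divide_right_mono mult_left_mono) auto
          then show "2 * (pstar - d i) / \<beta> \<le> r\<^sup>2 * (2 * (pstar - d 1) / \<beta>)"
            by (simp only: times_divide_eq_right mult.left_commute)
        qed fact
        also have "\<dots> = M * sqrt (2 * (pstar - d 1) / \<beta>) * r"
          using r(1) by (simp only: real_sqrt_mult real_sqrt_abs abs_of_nonneg mult_ac)
        also have "\<dots> \<le> ?m * r" using r(1) by (intro mult_right_mono) auto
        finally show ?thesis .
      next
        \<comment> \<open>Here \<open>K \<le> pstar - d i\<close>, so the gap is at most twice the
          suboptimality. The latter decays like \<open>r\<^sup>2\<close>, which is at most
          \<open>r\<close>, the rate of the other regime.\<close>
        case False
        have "r\<^sup>2 \<le> r" using r by (simp add: power2_eq_square mult_left_le)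
        then have "r\<^sup>2 * (pstar - d 1) \<le> r * (pstar - d 1)" using D1 by (rule mult_right_mono)
        with Di have "pstar - d i \<le> r * (pstar - d 1)" by (rule order_trans)
        then have "p i - d i \<le> 2 * (r * (pstar - d 1))"
          using large[OF perf] False by linarith
        also have "\<dots> = 2 * (pstar - d 1) * r" by (simp only: mult_ac)
        also have "\<dots> \<le> ?m * r" using r(1) by (intro mult_right_mono) auto
        finally show ?thesis .
      qed
      then show "p i - d i \<le> ?m * sqrt (1 - \<rho>) ^ (i - 1)" by (simp only: r_def)
    qed
  qed
  moreover have "pstar - d i \<ge> M\<^sup>2 / (2 * \<beta>) \<longrightarrow> p i - d i \<le> (pstar - d i) + M\<^sup>2 / (2 * \<beta>)"
    "\<not> pstar - d i \<ge> M\<^sup>2 / (2 * \<beta>) \<longrightarrow> p i - d i \<le> M * sqrt (2 * (pstar - d i) / \<beta>)"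
    if "lkm_performed g F \<epsilon> V x i" for i
    using large[OF that] small[OF that] by (auto simp: K_def)
  ultimately show ?thesis by blast
qed

end
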